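(* Let $Q$ be a smooth $n$-dimensional manifold and let $L\in C^\infty(TQ)$ be a (possibly singular) Lagrangian such that the rank of $T\mathcal{F}L$ is constant and the equation $i(\Gamma)\omega_L=dE_L$ has a second order differential equation solution $\Gamma$ defined everywhere on $TQ$. For $v\in TQ$ put $$\mathcal{A}_v=\{V\in T_v(TQ)\mid T\tau_Q(V)=v \text{ and } i(V)\omega_L|_v=dE_L|_v\},$$ and let $\mathcal{A}=\bigcup_{v}\mathcal{A}_v\to TQ$ be the resulting affine bundle. For a vector field $X\colon Q\to TQ$ the following conditions are equivalent: 1. $X$ is a solution of the generalized Lagrangian Hamilton--Jacobi problem. 2. $\mathrm{Im}(TX\circ X)\subset\mathcal{A}|_{\mathrm{Im}\,X}$. 3. $i(X)(X^*\omega_L)=d(X^*E_L)$. 4. For every $v\in\mathrm{Im}\,X$ there exists $w\in\mathcal{A}_v$ such that $w$ is tangent to $\mathrm{Im}\,X$. 5. For every initial condition $v\in\mathrm{Im}\,X$ there is a solution of the Euler--Lagrange equations (with initial condition $v$) which is entirely contained in the submanifold $\mathrm{Im}\,X$.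
   Context: $\tau_Q\colon TQ\to Q$ has natural coordinates $(q^i,v^i)$. For $L\in C^\infty(TQ)$: $\theta_L=\frac{\partial L}{\partial v^i}dq^i$, $\omega_L=-d\theta_L$, $E_L=\Delta(L)-L$ with $\Delta=v^i\frac{\partial}{\partial v^i}$ the Liouville vector field. $\mathcal{F}L\colon TQ\to T^*Q$ is the Legendre map (fibre derivative of $L$), $\mathcal{F}L(q,v)=(q^i,\partial L/\partial v^i)$. A second order differential equation field is a vector field $\Gamma$ on $TQ$ with $T\tau_Q\circ\Gamma=\mathrm{Id}_{TQ}$. A vector field $X$ on $Q$ is regarded as a section $X\colon Q\to TQ$ of $\tau_Q$, and $X^*$ is pull-back along this map. A curve $\gamma$ in $Q$ (on an open interval) is a solution of the Euler--Lagrange equations if $\xi=\dot\gamma$ satisfies $i(\dot\xi)\omega_L=dE_L\circ\xi$; equivalently $\dot\xi(t)\in\mathcal{A}_{\xi(t)}$ for every $t$. Its initial condition is $\dot\gamma(0)\in TQ$, and "contained in $\mathrm{Im}\,X$" means that $\dot\gamma(t)\in\mathrm{Im}\,X$ for all $t$. $X$ is a solution of the generalized Lagrangian Hamilton--Jacobi problem if, for every integral curve $\gamma$ of $X$ (on an open interval), $\xi=X\circ\gamma=\dot\gamma$ satisfies $i(\dot\xi)\omega_L=dE_L\circ\xi$. *)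

theory Defs
  imports "HOL-Analysis.Analysis"
begin

section \<open>Smooth maps between Euclidean spaces\<close>

text \<open>On an open set of a finite-dimensional space, \<open>Ck_on k f U\<close> says that all iterated directional
  derivatives of order at most \<open>k\<close> exist as derivatives and are continuous, i.e. that \<open>f\<close> is
  of class \<open>C^k\<close>.\<close>

primrec Ck_on :: "nat \<Rightarrow> ('e::real_normed_vector \<Rightarrow> 'f::real_normed_vector) \<Rightarrow> 'e set \<Rightarrow> bool" where
  "Ck_on 0 f U \<longleftrightarrow> continuous_on U f"
| "Ck_on (Suc k) f U \<longleftrightarrow> (\<forall>x\<in>U. f differentiable (at x)) \<and>
     (\<forall>v. Ck_on k (\<lambda>x. frechet_derivative f (at x) v) U)"

definition smooth_on :: "('e::real_normed_vector \<Rightarrow> 'f::real_normed_vector) \<Rightarrow> 'e set \<Rightarrow> bool" where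
  "smooth_on f U \<longleftrightarrow> (\<forall>k. Ck_on k f U)"


section \<open>Smooth manifolds\<close>

text \<open>A chart is a pair of its domain and its coordinate map; only the values on the domain matter.
  The topology of a manifold is the one determined by its atlas.\<close>

type_synonym ('a, 'e) chart = "'a set \<times> ('a \<Rightarrow> 'e)"
type_synonym ('a, 'e) atlas = "('a, 'e) chart set"

abbreviation cdom :: "('a, 'e) chart \<Rightarrow> 'a set" where "cdom c \<equiv> fst c"
abbreviation cmap :: "('a, 'e) chart \<Rightarrow> 'a \<Rightarrow> 'e" where "cmap c \<equiv> snd c"

definition cinv :: "('a, 'e) chart \<Rightarrow> 'e \<Rightarrow> 'a" where
  "cinv c = inv_into (cdom c) (cmap c)"

definition points :: "('a, 'e) atlas \<Rightarrow> 'a set" where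
  "points A = (\<Union>c\<in>A. cdom c)"

definition charts_at :: "('a, 'e) atlas \<Rightarrow> 'a \<Rightarrow> ('a, 'e) chart set" where
  "charts_at A p = {c \<in> A. p \<in> cdom c}"

text \<open>An auxiliary choice of a chart around each point, used below only to evaluate
  expressions whose value does not depend on the chart.\<close>

definition chart_at :: "('a, 'e) atlas \<Rightarrow> 'a \<Rightarrow> ('a, 'e) chart" where
  "chart_at A p = (SOME c. c \<in> charts_at A p)"

definition smooth_atlas :: "('a, 'e::euclidean_space) atlas \<Rightarrow> bool" where
  "smooth_atlas A \<longleftrightarrow>
     (\<forall>c\<in>A. inj_on (cmap c) (cdom c) \<and> open (cmap c ` cdom c)) \<and>
     (\<forall>c\<in>A. \<forall>d\<in>A. open (cmap c ` (cdom c \<inter> cdom d)) \<and>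
        smooth_on (cmap d \<circ> cinv c) (cmap c ` (cdom c \<inter> cdom d)))"

definition manifold_topology :: "('a, 'e::euclidean_space) atlas \<Rightarrow> 'a topology" where
  "manifold_topology A =
     topology (\<lambda>U. U \<subseteq> points A \<and> (\<forall>c\<in>A. open (cmap c ` (U \<inter> cdom c))))"

lemma openin_manifold_topology:
  assumes "smooth_atlas A"
  shows "openin (manifold_topology A) U \<longleftrightarrow>
    U \<subseteq> points A \<and> (\<forall>c\<in>A. open (cmap c ` (U \<inter> cdom c)))"
proof -
  have "istopology (\<lambda>U. U \<subseteq> points A \<and> (\<forall>c\<in>A. open (cmap c ` (U \<inter> cdom c))))"
    unfolding istopology_def
  proof (intro conjI allI impI)
    fix S T
    assume S: "S \<subseteq> points A \<and> (\<forall>c\<in>A. open (cmap c ` (S \<inter> cdom c)))"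
      and T: "T \<subseteq> points A \<and> (\<forall>c\<in>A. open (cmap c ` (T \<inter> cdom c)))"
    show "S \<inter> T \<subseteq> points A" using S by blast
    show "\<forall>c\<in>A. open (cmap c ` (S \<inter> T \<inter> cdom c))"
    proof
      fix c assume c: "c \<in> A"
      have "inj_on (cmap c) (cdom c)"
        using assms c unfolding smooth_atlas_def by blast
      then have "cmap c ` (S \<inter> T \<inter> cdom c)
          = cmap c ` (S \<inter> cdom c) \<inter> cmap c ` (T \<inter> cdom c)"
        by (auto simp: inj_on_def)
      then show "open (cmap c ` (S \<inter> T \<inter> cdom c))"
        using S T c by (simp add: open_Int)
    qed
  next
    fix K
    assume K: "\<forall>U\<in>K. U \<subseteq> points A \<and> (\<forall>c\<in>A. open (cmap c ` (U \<inter> cdom c)))"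
    show "\<Union> K \<subseteq> points A" using K by blast
    show "\<forall>c\<in>A. open (cmap c ` (\<Union> K \<inter> cdom c))"
    proof
      fix c assume c: "c \<in> A"
      have "cmap c ` (\<Union> K \<inter> cdom c) = (\<Union>U\<in>K. cmap c ` (U \<inter> cdom c))" by blast
      then show "open (cmap c ` (\<Union> K \<inter> cdom c))" using K c by (metis (no_types, lifting) open_UN)
    qed
  qed
  then show ?thesis unfolding manifold_topology_def by (simp add: topology_inverse')
qed

definition smooth_manifold :: "('a, 'e::euclidean_space) atlas \<Rightarrow> bool" where
  "smooth_manifold A \<longleftrightarrow> smooth_atlas A \<and>
     Hausdorff_space (manifold_topology A) \<and> second_countable (manifold_topology A)"

text \<open>Continuity is the openness of the sets \<open>cmap c ` (cdom c \<inter> F -` cdom d)\<close>.\<close>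

definition smooth_map ::
  "('a, 'e::euclidean_space) atlas \<Rightarrow> ('b, 'f::euclidean_space) atlas \<Rightarrow> ('a \<Rightarrow> 'b) \<Rightarrow> bool" where
  "smooth_map A B F \<longleftrightarrow> F ` points A \<subseteq> points B \<and>
     (\<forall>c\<in>A. \<forall>d\<in>B. open (cmap c ` (cdom c \<inter> F -` cdom d)) \<and>
        smooth_on (cmap d \<circ> F \<circ> cinv c) (cmap c ` (cdom c \<inter> F -` cdom d)))"

definition smooth_fun :: "('a, 'e::euclidean_space) atlas \<Rightarrow> ('a \<Rightarrow> real) \<Rightarrow> bool" where
  "smooth_fun A f \<longleftrightarrow> (\<forall>c\<in>A. smooth_on (f \<circ> cinv c) (cmap c ` cdom c))"


section \<open>The tangent bundle\<close>

text \<open>A tangent vector at \<open>p\<close> is the pair of \<open>p\<close> and the family of its components in all charts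
  around \<open>p\<close>, subject to the transformation law of contravariant vectors; the family is \<open>0\<close> at all
  other charts.\<close>

type_synonym ('a, 'e) tangent = "'a \<times> (('a, 'e) chart \<Rightarrow> 'e)"

definition tangent_space :: "('a, 'e::euclidean_space) atlas \<Rightarrow> 'a \<Rightarrow> ('a, 'e) tangent set" where
  "tangent_space A p = {(p, f) | f.
     (\<forall>c. c \<notin> charts_at A p \<longrightarrow> f c = 0) \<and>
     (\<forall>c\<in>charts_at A p. \<forall>d\<in>charts_at A p.
        f d = frechet_derivative (cmap d \<circ> cinv c) (at (cmap c p)) (f c))}"

definition tangent_points :: "('a, 'e::euclidean_space) atlas \<Rightarrow> ('a, 'e) tangent set" where
  "tangent_points A = (\<Union>p\<in>points A. tangent_space A p)"

text \<open>The vector at \<open>p\<close> with components \<open>u\<close> in the chart \<open>c\<close>.\<close>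

definition tangent_of ::
  "('a, 'e::euclidean_space) atlas \<Rightarrow> ('a, 'e) chart \<Rightarrow> 'a \<Rightarrow> 'e \<Rightarrow> ('a, 'e) tangent" where
  "tangent_of A c p u = (p, \<lambda>d. if d \<in> charts_at A p
      then frechet_derivative (cmap d \<circ> cinv c) (at (cmap c p)) u else 0)"

definition tangent_add ::
  "('a, 'e::euclidean_space) tangent \<Rightarrow> ('a, 'e) tangent \<Rightarrow> ('a, 'e) tangent" where
  "tangent_add V W = (fst V, \<lambda>c. snd V c + snd W c)"

definition tangent_scale ::
  "real \<Rightarrow> ('a, 'e::euclidean_space) tangent \<Rightarrow> ('a, 'e) tangent" where
  "tangent_scale r V = (fst V, \<lambda>c. r *\<^sub>R snd V c)"

definition natural_chart ::
  "('a, 'e::euclidean_space) atlas \<Rightarrow> ('a, 'e) chart \<Rightarrow> (('a, 'e) tangent, 'e \<times> 'e) chart" where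
  "natural_chart A c = ({V \<in> tangent_points A. fst V \<in> cdom c}, \<lambda>V. (cmap c (fst V), snd V c))"

definition tangent_bundle ::
  "('a, 'e::euclidean_space) atlas \<Rightarrow> (('a, 'e) tangent, 'e \<times> 'e) atlas" where
  "tangent_bundle A = natural_chart A ` A"

definition tangent_map ::
  "('a, 'e::euclidean_space) atlas \<Rightarrow> ('b, 'f::euclidean_space) atlas \<Rightarrow> ('a \<Rightarrow> 'b) \<Rightarrow>
   ('a, 'e) tangent \<Rightarrow> ('b, 'f) tangent" where
  "tangent_map A B F V = (let p = fst V; c = chart_at A p in
     (F p, \<lambda>d. if d \<in> charts_at B (F p)
       then frechet_derivative (cmap d \<circ> F \<circ> cinv c) (at (cmap c p)) (snd V c) else 0))"

text \<open>The rank of the tangent map at \<open>p\<close> is the dimension of its image, computed through the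
  isomorphism of the target tangent space with the model space given by a chart.\<close>

definition tangent_map_rank ::
  "('a, 'e::euclidean_space) atlas \<Rightarrow> ('b, 'f::euclidean_space) atlas \<Rightarrow> ('a \<Rightarrow> 'b) \<Rightarrow> 'a \<Rightarrow> nat" where
  "tangent_map_rank A B F p =
     dim ((\<lambda>V. snd (tangent_map A B F V) (chart_at B (F p))) ` tangent_space A p)"

definition vector_field ::
  "('a, 'e::euclidean_space) atlas \<Rightarrow> ('a \<Rightarrow> ('a, 'e) tangent) \<Rightarrow> bool" where
  "vector_field A X \<longleftrightarrow>
     smooth_map A (tangent_bundle A) X \<and> (\<forall>p\<in>points A. fst (X p) = p)"


section \<open>Curves\<close>

definition smooth_curve :: "('a, 'e::euclidean_space) atlas \<Rightarrow> real set \<Rightarrow> (real \<Rightarrow> 'a) \<Rightarrow> bool" where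
  "smooth_curve A I \<gamma> \<longleftrightarrow> open I \<and> is_interval I \<and> smooth_map {(I, \<lambda>t. t)} A \<gamma>"

definition velocity :: "('a, 'e::euclidean_space) atlas \<Rightarrow> (real \<Rightarrow> 'a) \<Rightarrow> real \<Rightarrow> ('a, 'e) tangent" where
  "velocity A \<gamma> t = (\<gamma> t, \<lambda>c. if c \<in> charts_at A (\<gamma> t)
     then vector_derivative (cmap c \<circ> \<gamma>) (at t) else 0)"

definition integral_curve ::
  "('a, 'e::euclidean_space) atlas \<Rightarrow> ('a \<Rightarrow> ('a, 'e) tangent) \<Rightarrow> real set \<Rightarrow> (real \<Rightarrow> 'a) \<Rightarrow> bool" where
  "integral_curve A X I \<gamma> \<longleftrightarrow> smooth_curve A I \<gamma> \<and> (\<forall>t\<in>I. velocity A \<gamma> t = X (\<gamma> t))"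

text \<open>A vector is tangent to a submanifold \<open>S\<close> if it is the velocity of a curve of the ambient
  manifold that lies in \<open>S\<close>.\<close>

definition tangent_to ::
  "('a, 'e::euclidean_space) atlas \<Rightarrow> 'a set \<Rightarrow> ('a, 'e) tangent \<Rightarrow> bool" where
  "tangent_to A S w \<longleftrightarrow> (\<exists>I \<gamma>. 0 \<in> I \<and> smooth_curve A I \<gamma> \<and> \<gamma> ` I \<subseteq> S \<and> velocity A \<gamma> 0 = w)"


section \<open>Differential forms\<close>

text \<open>1-forms and 2-forms are functions of one, respectively two, tangent vectors (at a common
  point).\<close>

definition differential ::
  "('a, 'e::euclidean_space) atlas \<Rightarrow> ('a \<Rightarrow> real) \<Rightarrow> ('a, 'e) tangent \<Rightarrow> real" where
  "differential A f V = (let p = fst V; c = chart_at A p in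
     frechet_derivative (f \<circ> cinv c) (at (cmap c p)) (snd V c))"

text \<open>Exterior derivative of a 1-form, with the convention \<open>d\<alpha>(V,W) = V(\<alpha>(W)) - W(\<alpha>(V))\<close> for
  vector fields \<open>V\<close>, \<open>W\<close> with constant components in a chart (no factor \<open>1/2\<close>).\<close>

definition ext_derivative ::
  "('a, 'e::euclidean_space) atlas \<Rightarrow> (('a, 'e) tangent \<Rightarrow> real) \<Rightarrow>
   ('a, 'e) tangent \<Rightarrow> ('a, 'e) tangent \<Rightarrow> real" where
  "ext_derivative A \<alpha> V W = (let p = fst V; c = chart_at A p in
     frechet_derivative (\<lambda>x. \<alpha> (tangent_of A c (cinv c x) (snd W c))) (at (cmap c p)) (snd V c)
   - frechet_derivative (\<lambda>x. \<alpha> (tangent_of A c (cinv c x) (snd V c))) (at (cmap c p)) (snd W c))"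

definition pullback2 ::
  "('a, 'e::euclidean_space) atlas \<Rightarrow> ('b, 'f::euclidean_space) atlas \<Rightarrow> ('a \<Rightarrow> 'b) \<Rightarrow>
   (('b, 'f) tangent \<Rightarrow> ('b, 'f) tangent \<Rightarrow> real) \<Rightarrow> ('a, 'e) tangent \<Rightarrow> ('a, 'e) tangent \<Rightarrow> real" where
  "pullback2 A B F \<omega> V W = \<omega> (tangent_map A B F V) (tangent_map A B F W)"


section \<open>The cotangent bundle\<close>

text \<open>A covector at \<open>p\<close> is a pair of \<open>p\<close> and a linear form on the tangent space at \<open>p\<close>, extended
  by \<open>0\<close>. The natural fibre coordinates \<open>p\<^sub>i = \<alpha>(\<partial>/\<partial>q\<^sup>i)\<close> are assembled into a vector of the
  model space.\<close>

type_synonym ('a, 'e) cotangent = "'a \<times> (('a, 'e) tangent \<Rightarrow> real)"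

definition cotangent_space :: "('a, 'e::euclidean_space) atlas \<Rightarrow> 'a \<Rightarrow> ('a, 'e) cotangent set" where
  "cotangent_space A p = {(p, \<alpha>) | \<alpha>.
     (\<forall>V. V \<notin> tangent_space A p \<longrightarrow> \<alpha> V = 0) \<and>
     (\<forall>V\<in>tangent_space A p. \<forall>W\<in>tangent_space A p. \<alpha> (tangent_add V W) = \<alpha> V + \<alpha> W) \<and>
     (\<forall>r. \<forall>V\<in>tangent_space A p. \<alpha> (tangent_scale r V) = r * \<alpha> V)}"

definition cotangent_chart ::
  "('a, 'e::euclidean_space) atlas \<Rightarrow> ('a, 'e) chart \<Rightarrow> (('a, 'e) cotangent, 'e \<times> 'e) chart" where
  "cotangent_chart A c = (\<Union>p\<in>cdom c. cotangent_space A p,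
     \<lambda>a. (cmap c (fst a), \<Sum>b\<in>Basis. snd a (tangent_of A c (fst a) b) *\<^sub>R b))"

definition cotangent_bundle ::
  "('a, 'e::euclidean_space) atlas \<Rightarrow> (('a, 'e) cotangent, 'e \<times> 'e) atlas" where
  "cotangent_bundle A = cotangent_chart A ` A"


section \<open>Lagrangian mechanics\<close>

definition legendre ::
  "('a, 'e::euclidean_space) atlas \<Rightarrow> (('a, 'e) tangent \<Rightarrow> real) \<Rightarrow> ('a, 'e) tangent \<Rightarrow> ('a, 'e) cotangent"
  where
  "legendre A L w = (fst w, \<lambda>u. if u \<in> tangent_space A (fst w)
     then deriv (\<lambda>t. L (tangent_add w (tangent_scale t u))) 0 else 0)"

text \<open>\<open>\<theta>\<^sub>L = (\<partial>L/\<partial>v\<^sup>i) dq\<^sup>i\<close>, in natural coordinates around the base point.\<close>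

definition theta ::
  "('a, 'e::euclidean_space) atlas \<Rightarrow> (('a, 'e) tangent \<Rightarrow> real) \<Rightarrow>
   (('a, 'e) tangent, 'e \<times> 'e) tangent \<Rightarrow> real" where
  "theta A L V = (let w = fst V; N = natural_chart A (chart_at A (fst w)) in
     \<Sum>b\<in>Basis. frechet_derivative (L \<circ> cinv N) (at (cmap N w)) (0, b) * (fst (snd V N) \<bullet> b))"

definition omega ::
  "('a, 'e::euclidean_space) atlas \<Rightarrow> (('a, 'e) tangent \<Rightarrow> real) \<Rightarrow>
   (('a, 'e) tangent, 'e \<times> 'e) tangent \<Rightarrow> (('a, 'e) tangent, 'e \<times> 'e) tangent \<Rightarrow> real" where
  "omega A L V W = - ext_derivative (tangent_bundle A) (theta A L) V W"

text \<open>\<open>\<Delta> = v\<^sup>i \<partial>/\<partial>v\<^sup>i\<close>: in every natural chart \<open>N\<close>, the components are \<open>(0, v)\<close>, where \<open>v\<close> is the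
  second coordinate of the point.\<close>

definition liouville ::
  "('a, 'e::euclidean_space) atlas \<Rightarrow> ('a, 'e) tangent \<Rightarrow> (('a, 'e) tangent, 'e \<times> 'e) tangent" where
  "liouville A w =
     (w, \<lambda>N. if N \<in> charts_at (tangent_bundle A) w then (0, snd (cmap N w)) else 0)"

definition energy ::
  "('a, 'e::euclidean_space) atlas \<Rightarrow> (('a, 'e) tangent \<Rightarrow> real) \<Rightarrow> ('a, 'e) tangent \<Rightarrow> real" where
  "energy A L w = differential (tangent_bundle A) L (liouville A w) - L w"

text \<open>The equation \<open>i(V)\<omega>\<^sub>L = dE\<^sub>L\<close> at the base point of \<open>V\<close>.\<close>

definition lagrange_eq ::
  "('a, 'e::euclidean_space) atlas \<Rightarrow> (('a, 'e) tangent \<Rightarrow> real) \<Rightarrow>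
   (('a, 'e) tangent, 'e \<times> 'e) tangent \<Rightarrow> bool" where
  "lagrange_eq A L V \<longleftrightarrow> (\<forall>W\<in>tangent_space (tangent_bundle A) (fst V).
     omega A L V W = differential (tangent_bundle A) (energy A L) W)"

definition sode ::
  "('a, 'e::euclidean_space) atlas \<Rightarrow>
   (('a, 'e) tangent \<Rightarrow> (('a, 'e) tangent, 'e \<times> 'e) tangent) \<Rightarrow> bool" where
  "sode A \<Gamma> \<longleftrightarrow> vector_field (tangent_bundle A) \<Gamma> \<and>
     (\<forall>v\<in>points (tangent_bundle A). tangent_map (tangent_bundle A) A fst (\<Gamma> v) = v)"

definition affine_fibre ::
  "('a, 'e::euclidean_space) atlas \<Rightarrow> (('a, 'e) tangent \<Rightarrow> real) \<Rightarrow> ('a, 'e) tangent \<Rightarrow>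
   (('a, 'e) tangent, 'e \<times> 'e) tangent set" where
  "affine_fibre A L v = {V \<in> tangent_space (tangent_bundle A) v.
     tangent_map (tangent_bundle A) A fst V = v \<and> lagrange_eq A L V}"

definition euler_lagrange_solution ::
  "('a, 'e::euclidean_space) atlas \<Rightarrow> (('a, 'e) tangent \<Rightarrow> real) \<Rightarrow> real set \<Rightarrow> (real \<Rightarrow> 'a) \<Rightarrow> bool" where
  "euler_lagrange_solution A L I \<gamma> \<longleftrightarrow> smooth_curve A I \<gamma> \<and>
     (\<forall>t\<in>I. lagrange_eq A L (velocity (tangent_bundle A) (velocity A \<gamma>) t))"

definition generalized_HJ_solution ::
  "('a, 'e::euclidean_space) atlas \<Rightarrow> (('a, 'e) tangent \<Rightarrow> real) \<Rightarrow> ('a \<Rightarrow> ('a, 'e) tangent) \<Rightarrow> bool" where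
  "generalized_HJ_solution A L X \<longleftrightarrow> (\<forall>I \<gamma>. integral_curve A X I \<gamma> \<longrightarrow>
     (\<forall>t\<in>I. lagrange_eq A L (velocity (tangent_bundle A) (X \<circ> \<gamma>) t)))"

end

theory Submission
  imports Defs
begin

text \<open>All five conditions say that \<open>TX(X(p))\<close> satisfies the Lagrange equation at every point \<open>p\<close>. For
  (2) this is the definition, since \<open>TX \<circ> X\<close> is automatically of second order. For (1), (4) and (5), a curve
  with values in \<open>Im X\<close> is \<open>X \<circ> \<gamma>\<close> for its projection \<open>\<gamma>\<close>, so its velocity is \<open>TX(\<gamma>')\<close>, which is
  \<open>TX(X(p))\<close> when \<open>\<gamma>' = X(p)\<close>; conversely there are integral curves of \<open>X\<close> through all points. For (3), when
  \<open>V\<close> is of second order, the 1-form \<open>i(V)\<omega>\<^sub>L - dE\<^sub>L\<close> is semibasic, so it is determined by its values on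
  \<open>Im TX\<close>, that is, by its pull-back along \<open>X\<close>.\<close>

text \<open>The main obstacle is that \<open>theta\<close>, \<open>differential\<close> and
  \<open>tangent_map\<close> are evaluated in a chart picked by \<open>chart_at\<close>, and this
  choice varies from point to point without any regularity. Since \<open>omega\<close>
  differentiates \<open>theta\<close> over a neighbourhood, \<open>theta\<close> must first be
  rewritten in one fixed natural chart; the chart-independence lemmas serve this purpose.

  The pull-back along \<open>X\<close> loses no information because T\<tau> \<circ> TX = id: for
  every W at X(p), the vectors W and TX(T\<tau>(W)) have the same projection to Q, so a semibasic
  form takes the same value on both.

  Integral curves are needed only on some interval around 0, so a local existence theorem in one
  chart is enough. It is obtained from Banach's fixed point theorem.

  \<open>Ck_on\<close> controls derivatives along constant directions only. Whenever a direction
  varies with the point, linearity and a basis expansion reduce it to constant directions.\<close>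

abbreviation Dat :: "('e::real_normed_vector \<Rightarrow> 'f::real_normed_vector) \<Rightarrow> 'e \<Rightarrow> 'e \<Rightarrow> 'f" where
  "Dat f x \<equiv> frechet_derivative f (at x)"

section \<open>Calculus of smooth maps\<close>

lemma Dat_eqI: "(f has_derivative f') (at x) \<Longrightarrow> Dat f x = f'"
  using frechet_derivative_at by metis

lemma Ck_on_continuous_on: "Ck_on k f U \<Longrightarrow> continuous_on U f"
  by (cases k)
    (auto intro: continuous_at_imp_continuous_on differentiable_imp_continuous_within)

text \<open>On an open set a derivative at a point depends only on values inside the set, so
  agreement on \<open>U\<close> is inherited by all iterated derivatives.\<close>

lemma Ck_on_cong:
  assumes "open U" "\<And>x. x \<in> U \<Longrightarrow> f x = g x" "Ck_on k f U"
  shows "Ck_on k g U"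
  using assms(2,3)
proof (induction k arbitrary: f g)
  case 0
  then show ?case using continuous_on_cong[of U U f g] by simp
next
  case (Suc k)
  have g: "(g has_derivative Dat f x) (at x)" if "x \<in> U" for x
    using Suc.prems that assms(1)
    by (intro has_derivative_transform_within_open[of f _ x UNIV U g])
      (auto simp: frechet_derivative_works)
  have "g differentiable at x" if "x \<in> U" for x using g[OF that] by (rule differentiableI)
  moreover have "Ck_on k (\<lambda>x. Dat g x v) U" for v
    by (rule Suc.IH[of "\<lambda>x. Dat f x v"]) (use Suc.prems(2) in \<open>simp_all add: Dat_eqI[OF g]\<close>)
  ultimately show ?case by simp
qed

text \<open>Lets the inductions below work with an explicit formula for the derivative in place of
  \<open>frechet_derivative\<close>.\<close>

lemma Ck_on_SucI:
  assumes "open U" "\<And>x. x \<in> U \<Longrightarrow> (f has_derivative f' x) (at x)"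
    and "\<And>v. Ck_on k (\<lambda>x. f' x v) U"
  shows "Ck_on (Suc k) f U"
  unfolding Ck_on.simps
proof (intro conjI ballI allI)
  show "f differentiable at x" if "x \<in> U" for x using assms(2)[OF that] by (rule differentiableI)
  show "Ck_on k (\<lambda>x. Dat f x v) U" for v
    by (rule Ck_on_cong[OF assms(1) _ assms(3)[of v]]) (simp add: Dat_eqI[OF assms(2)])
qed

text \<open>\<open>Ck_on (Suc k)\<close> does not mention continuity of \<open>f\<close> itself; at
  the bottom of the induction it comes from differentiability.\<close>

lemma Ck_on_SucD: "Ck_on (Suc k) f U \<Longrightarrow> Ck_on k f U"
proof (induction k arbitrary: f)
  case 0
  then show ?case using Ck_on_continuous_on[of "Suc 0" f U] by simp
next
  case (Suc k)
  from Suc.prems have "\<forall>x\<in>U. f differentiable at x" "\<And>v. Ck_on (Suc k) (\<lambda>x. Dat f x v) U"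
    using Ck_on.simps(2) by blast+
  then show ?case using Suc.IH by simp
qed

lemma Ck_on_has_derivative:
  "Ck_on (Suc k) f U \<Longrightarrow> x \<in> U \<Longrightarrow> (f has_derivative Dat f x) (at x)"
  by (simp add: frechet_derivative_works)

lemma Ck_on_subset: "Ck_on k f U \<Longrightarrow> W \<subseteq> U \<Longrightarrow> Ck_on k f W"
  by (induction k arbitrary: f) (auto intro: continuous_on_subset)

lemma Ck_on_local:
  assumes "\<And>x. x \<in> U \<Longrightarrow> \<exists>W. open W \<and> x \<in> W \<and> Ck_on k f W"
  shows "Ck_on k f U"
  using assms
proof (induction k arbitrary: f)
  case 0
  then show ?case
    by (metis Ck_on.simps(1) continuous_at_imp_continuous_on continuous_on_eq_continuous_at)
next
  case (Suc k)
  have "f differentiable at x" if "x \<in> U" for x using Suc.prems[OF that] by auto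
  moreover have "Ck_on k (\<lambda>x. Dat f x v) U" for v
    by (intro Suc.IH) (use Suc.prems in fastforce)
  ultimately show ?case by simp
qed

lemma Ck_on_const: "Ck_on k (\<lambda>x. a) U"
  by (induction k arbitrary: a) auto

lemma Ck_on_bounded_linear:
  assumes "bounded_linear f"
  shows "Ck_on k f U"
proof (cases k)
  case 0
  then show ?thesis using assms by (simp add: linear_continuous_on)
next
  case (Suc k)
  have f: "(f has_derivative f) (at x)" for x by (rule bounded_linear_imp_has_derivative[OF assms])
  show ?thesis by (simp add: Suc Ck_on_const Dat_eqI[OF f] differentiableI[OF f])
qed

lemma Ck_on_add:
  assumes "open U"
  shows "Ck_on k f U \<Longrightarrow> Ck_on k g U \<Longrightarrow> Ck_on k (\<lambda>x. f x + g x) U"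
proof (induction k arbitrary: f g)
  case 0
  then show ?case by (simp add: continuous_on_add)
next
  case (Suc k)
  show ?case
  proof (rule Ck_on_SucI[OF assms])
    show "((\<lambda>x. f x + g x) has_derivative (\<lambda>v. Dat f x v + Dat g x v)) (at x)" if "x \<in> U" for x
      by (rule has_derivative_add[OF Ck_on_has_derivative Ck_on_has_derivative, OF Suc.prems(1) that Suc.prems(2) that])
  qed (use Suc in auto)
qed

lemma Ck_on_sum:
  assumes "open U" "finite S" "\<And>i. i \<in> S \<Longrightarrow> Ck_on k (f i) U"
  shows "Ck_on k (\<lambda>x. \<Sum>i\<in>S. f i x) U"
  using assms(2,3) by (induction S rule: finite_induct) (auto intro: Ck_on_const Ck_on_add assms(1))

text \<open>By the Leibniz rule the derivative is a sum of two terms of the same bilinear shape, so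
  the induction closes once the undifferentiated factor is weakened by one order. Both scalar
  multiplication and the inner product are covered.\<close>

lemma Ck_on_bilinear:
  assumes "bounded_bilinear B" "open U"
  shows "Ck_on k f U \<Longrightarrow> Ck_on k g U \<Longrightarrow> Ck_on k (\<lambda>x. B (f x) (g x)) U"
proof (induction k arbitrary: f g)
  case 0
  then show ?case using bounded_bilinear.continuous_on[OF assms(1)] by simp
next
  case (Suc k)
  show ?case
  proof (rule Ck_on_SucI[OF assms(2)])
    show "((\<lambda>x. B (f x) (g x)) has_derivative (\<lambda>v. B (f x) (Dat g x v) + B (Dat f x v) (g x))) (at x)"
      if "x \<in> U" for x
      using bounded_bilinear.FDERIV[OF assms(1) Ck_on_has_derivative Ck_on_has_derivative, OF Suc.prems(1) that Suc.prems(2) that] .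
    show "Ck_on k (\<lambda>x. B (f x) (Dat g x v) + B (Dat f x v) (g x)) U" for v
      by (intro Ck_on_add assms(2) Suc.IH Ck_on_SucD[OF Suc.prems(1)] Ck_on_SucD[OF Suc.prems(2)])
        (use Suc.prems in simp_all)
  qed
qed

lemma Ck_on_Pair:
  assumes "open U"
  shows "Ck_on k f U \<Longrightarrow> Ck_on k g U \<Longrightarrow> Ck_on k (\<lambda>x. (f x, g x)) U"
proof (induction k arbitrary: f g)
  case 0
  then show ?case by (simp add: continuous_on_Pair)
next
  case (Suc k)
  show ?case
  proof (rule Ck_on_SucI[OF assms])
    show "((\<lambda>x. (f x, g x)) has_derivative (\<lambda>v. (Dat f x v, Dat g x v))) (at x)"
      if "x \<in> U" for x
      by (rule has_derivative_Pair[OF Ck_on_has_derivative Ck_on_has_derivative, OF Suc.prems(1) that Suc.prems(2) that])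
  qed (use Suc in auto)
qed

lemma linear_Basis_expand:
  fixes f :: "'e::euclidean_space \<Rightarrow> 'f::real_vector"
  assumes "linear f"
  shows "f v = (\<Sum>b\<in>Basis. (v \<bullet> b) *\<^sub>R f b)"
  by (subst euclidean_representation[of v, symmetric])
    (simp add: linear_sum[OF assms] linear_cmul[OF assms])

lemma linear_Pair_zero: "linear f \<Longrightarrow> linear (\<lambda>a. f (0, a))"
  using linear_compose[of "\<lambda>a. (0, a)" f] by (simp add: comp_def linear_iff)

text \<open>The chain rule yields the derivative of \<open>f\<close> at \<open>g x\<close> in the
  direction \<open>Dat g x v\<close>, which varies with \<open>x\<close>. Expanding this direction
  in the basis gives products of coordinates of \<open>Dat g x v\<close> with derivatives of
  \<open>f\<close> along constant vectors, and to the latter the induction hypothesis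
  applies.\<close>

lemma Ck_on_compose:
  fixes f :: "'e::euclidean_space \<Rightarrow> 'f::real_normed_vector"
  assumes "open U" "open V" "g ` U \<subseteq> V"
  shows "Ck_on k f V \<Longrightarrow> Ck_on k g U \<Longrightarrow> Ck_on k (\<lambda>x. f (g x)) U"
proof (induction k arbitrary: f)
  case 0
  then show ?case using assms continuous_on_compose2 by (metis Ck_on.simps(1))
next
  case (Suc k)
  let ?h = "\<lambda>x v. \<Sum>b\<in>Basis. (Dat g x v \<bullet> b) *\<^sub>R Dat f (g x) b"
  show ?case
  proof (rule Ck_on_SucI[OF assms(1)])
    fix x assume x: "x \<in> U"
    have f: "(f has_derivative Dat f (g x)) (at (g x))"
      using x assms by (intro Ck_on_has_derivative[OF Suc.prems(1)]) auto
    have "((\<lambda>x. f (g x)) has_derivative (\<lambda>v. Dat f (g x) (Dat g x v))) (at x)"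
      by (rule has_derivative_compose[OF Ck_on_has_derivative[OF Suc.prems(2) x] f])
    moreover have "Dat f (g x) (Dat g x v) = ?h x v" for v
      by (rule linear_Basis_expand) (rule has_derivative_linear[OF f])
    ultimately show "((\<lambda>x. f (g x)) has_derivative ?h x) (at x)" by simp
  next
    show "Ck_on k (\<lambda>x. ?h x v) U" for v
    proof (intro Ck_on_sum[OF assms(1)] finite_Basis Ck_on_bilinear[OF bounded_bilinear_scaleR assms(1)])
      fix b :: 'e
      show "Ck_on k (\<lambda>x. Dat g x v \<bullet> b) U"
        using Suc.prems by (intro Ck_on_bilinear[OF bounded_bilinear_inner assms(1)] Ck_on_const) auto
      show "Ck_on k (\<lambda>x. Dat f (g x) b) U"
        by (intro Suc.IH Ck_on_SucD[OF Suc.prems(2)]) (use Suc.prems in simp)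
    qed
  qed
qed

lemma smooth_on_cong:
  "open U \<Longrightarrow> (\<And>x. x \<in> U \<Longrightarrow> f x = g x) \<Longrightarrow> smooth_on f U \<Longrightarrow> smooth_on g U"
  unfolding smooth_on_def using Ck_on_cong by blast

lemma smooth_on_subset: "smooth_on f U \<Longrightarrow> W \<subseteq> U \<Longrightarrow> smooth_on f W"
  unfolding smooth_on_def using Ck_on_subset by blast

lemma smooth_on_continuous_on: "smooth_on f U \<Longrightarrow> continuous_on U f"
  unfolding smooth_on_def using Ck_on_continuous_on by blast

lemma smooth_on_has_derivative:
  "smooth_on f U \<Longrightarrow> x \<in> U \<Longrightarrow> (f has_derivative Dat f x) (at x)"
  unfolding smooth_on_def using Ck_on_has_derivative by blast

lemma smooth_on_differentiable: "smooth_on f U \<Longrightarrow> x \<in> U \<Longrightarrow> f differentiable at x"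
  using smooth_on_has_derivative by (rule differentiableI)

lemma smooth_on_derivative: "smooth_on f U \<Longrightarrow> smooth_on (\<lambda>x. Dat f x v) U"
  unfolding smooth_on_def by (metis Ck_on.simps(2))

lemma smooth_on_local:
  "(\<And>x. x \<in> U \<Longrightarrow> \<exists>W. open W \<and> x \<in> W \<and> smooth_on f W) \<Longrightarrow> smooth_on f U"
  unfolding smooth_on_def by (meson Ck_on_local)

lemma smooth_on_const: "smooth_on (\<lambda>x. a) U"
  unfolding smooth_on_def by (simp add: Ck_on_const)

lemma smooth_on_bounded_linear: "bounded_linear f \<Longrightarrow> smooth_on f U"
  unfolding smooth_on_def by (simp add: Ck_on_bounded_linear)

lemma smooth_on_sum:
  "open U \<Longrightarrow> finite S \<Longrightarrow> (\<And>i. i \<in> S \<Longrightarrow> smooth_on (f i) U) \<Longrightarrow> smooth_on (\<lambda>x. \<Sum>i\<in>S. f i x) U"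
  unfolding smooth_on_def by (simp add: Ck_on_sum)

lemma smooth_on_bilinear:
  "bounded_bilinear B \<Longrightarrow> open U \<Longrightarrow> smooth_on f U \<Longrightarrow> smooth_on g U \<Longrightarrow> smooth_on (\<lambda>x. B (f x) (g x)) U"
  unfolding smooth_on_def by (simp add: Ck_on_bilinear)

lemma smooth_on_diff:
  assumes "open U" "smooth_on f U" "smooth_on g U"
  shows "smooth_on (\<lambda>x. f x - g x) U"
proof -
  have "smooth_on (\<lambda>x. (-1) *\<^sub>R g x) U"
    by (rule smooth_on_bilinear[OF bounded_bilinear_scaleR assms(1) smooth_on_const assms(3)])
  then show ?thesis
    using assms Ck_on_add[OF assms(1), of _ f "\<lambda>x. (-1) *\<^sub>R g x"] unfolding smooth_on_def by simp
qed

lemma smooth_on_Pair: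
  "open U \<Longrightarrow> smooth_on f U \<Longrightarrow> smooth_on g U \<Longrightarrow> smooth_on (\<lambda>x. (f x, g x)) U"
  unfolding smooth_on_def by (simp add: Ck_on_Pair)

lemma smooth_on_compose:
  fixes f :: "'e::euclidean_space \<Rightarrow> 'f::real_normed_vector"
  shows "open U \<Longrightarrow> open V \<Longrightarrow> g ` U \<subseteq> V \<Longrightarrow> smooth_on f V \<Longrightarrow> smooth_on g U \<Longrightarrow>
    smooth_on (\<lambda>x. f (g x)) U"
  unfolding smooth_on_def by (simp add: Ck_on_compose)

section \<open>Ordinary differential equations\<close>

text \<open>Serves twice: for the contraction estimate of the Picard operator, and for confining a
  solution to a ball by its maximal speed.\<close>

lemma lipschitz_from_derivative:
  fixes u :: "real \<Rightarrow> 'e::real_normed_vector"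
  assumes "\<And>t. t \<in> {l..r} \<Longrightarrow> (u has_vector_derivative u' t) (at t within {l..r})"
    and "\<And>t. t \<in> {l..r} \<Longrightarrow> norm (u' t) \<le> M" "a \<in> {l..r}" "b \<in> {l..r}"
  shows "norm (u a - u b) \<le> M * \<bar>a - b\<bar>"
proof -
  have "onorm (\<lambda>s. s *\<^sub>R u' t) \<le> M" if "t \<in> {l..r}" for t
    using assms(2)[OF that] by (intro onorm_le) (simp add: mult.commute[of M] mult_left_mono)
  then have "norm (u a - u b) \<le> M * norm (a - b)"
    using assms(1) by (intro differentiable_bound[OF convex_real_interval(5) _ _ assms(3,4)])
      (auto simp: has_vector_derivative_def)
  then show ?thesis by simp
qed

text \<open>The Picard operator integrates over a segment of length at most \<open>d\<close>
  starting at 0, so it contracts the sup distance by \<open>K * d\<close>. Banach's theorem is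
  applied on the type of bounded continuous functions on the whole real line, which is
  complete.\<close>

lemma lipschitz_ODE_solution:
  fixes g :: "'e::euclidean_space \<Rightarrow> 'e"
  assumes lip: "\<And>x y. dist (g x) (g y) \<le> K * dist x y" and "0 \<le> K" "0 < d" "K * d < 1"
  obtains u where "u 0 = x0"
    "\<And>t. t \<in> {-d..d} \<Longrightarrow> (u has_vector_derivative g (u t)) (at t within {-d..d})"
proof -
  have cont_g: "continuous_on UNIV g"
    using assms(2) lip by (intro lipschitz_on_continuous_on[of K] lipschitz_onI) auto
  have cont: "continuous_on S (\<lambda>t. g (apply_bcontfun u t))" for S and u :: "real \<Rightarrow>\<^sub>C 'e"
    by (rule continuous_on_compose2[OF cont_g]) auto
  \<comment> \<open>The lower limit \<open>-d\<close> keeps the integral properly oriented for all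
    \<open>t\<close> in the interval, negative ones included; subtracting \<open>F u 0\<close> in
    \<open>P\<close> moves the initial time to 0.\<close>
  define F where "F u t = integral {-d..t} (\<lambda>s. g (apply_bcontfun u s))" for u and t :: real
  have F: "(F u has_vector_derivative g (apply_bcontfun u t)) (at t within {-d..d})"
    if "t \<in> {-d..d}" for u t
    unfolding F_def by (rule integral_has_vector_derivative[OF cont that])
  have cont_F: "continuous_on {-d..d} (F u)" for u
    using F by (meson continuous_on_eq_continuous_within has_vector_derivative_continuous)
  \<comment> \<open>Clamping time to the interval extends the Picard iterate to a bounded continuous
    function on all reals.\<close>
  define \<tau> where "\<tau> t = max (-d) (min d t)" for t
  have \<tau>: "\<tau> t \<in> {-d..d}" "\<bar>\<tau> t\<bar> \<le> d" for t using \<open>0 < d\<close> by (auto simp: \<tau>_def)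
  have \<tau>_eq: "\<tau> t = t" if "t \<in> {-d..d}" for t using that by (auto simp: \<tau>_def)
  define P where "P u t = x0 + (F u (\<tau> t) - F u 0)" for u t
  have P: "P u \<in> bcontfun" for u
  proof -
    have "continuous_on UNIV (\<lambda>t. F u (\<tau> t))"
      by (rule continuous_on_compose2[OF cont_F[of u]])
        (use \<tau>(1) in \<open>auto simp: \<tau>_def[abs_def] intro!: continuous_intros\<close>)
    then have "continuous_on UNIV (P u)"
      unfolding P_def[abs_def] by (intro continuous_intros)
    moreover have "bounded (F u ` {-d..d})"
      by (intro compact_imp_bounded compact_continuous_image cont_F) simp
    then have "bounded ((\<lambda>y. x0 - F u 0 + y) ` F u ` {-d..d})" by (rule bounded_translation)
    then have "bounded (range (P u))"
      by (rule bounded_subset) (use \<tau>(1) in \<open>auto simp: P_def algebra_simps\<close>)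
    ultimately show ?thesis by (simp add: bcontfun_def)
  qed
  have "dist (Bcontfun (P u)) (Bcontfun (P v)) \<le> K * d * dist u v" for u v
  proof (rule dist_bound)
    fix t
    \<comment> \<open>The difference \<open>F u - F v\<close> has derivative
      \<open>g (u s) - g (v s)\<close>, of norm at most \<open>K * dist u v\<close>; the mean value
      inequality from 0 to \<open>\<tau> t\<close> gives the contraction.\<close>
    have "norm ((F u (\<tau> t) - F v (\<tau> t)) - (F u 0 - F v 0)) \<le> K * dist u v * \<bar>\<tau> t - 0\<bar>"
    proof (rule lipschitz_from_derivative)
      fix s assume "s \<in> {-d..d}"
      then show "((\<lambda>t. F u t - F v t) has_vector_derivative g (apply_bcontfun u s) - g (apply_bcontfun v s))
          (at s within {-d..d})"
        by (intro has_vector_derivative_diff F)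
      have "norm (g (apply_bcontfun u s) - g (apply_bcontfun v s)) \<le> K * dist (apply_bcontfun u s) (apply_bcontfun v s)"
        using lip by (simp add: dist_norm)
      also have "\<dots> \<le> K * dist u v" by (intro mult_left_mono dist_bounded assms(2))
      finally show "norm (g (apply_bcontfun u s) - g (apply_bcontfun v s)) \<le> K * dist u v" .
    qed (use \<tau> \<open>0 < d\<close> in auto)
    also have "\<dots> \<le> K * dist u v * d" using \<tau>(2)[of t] assms(2) by (intro mult_left_mono) auto
    finally show "dist (apply_bcontfun (Bcontfun (P u)) t) (apply_bcontfun (Bcontfun (P v)) t) \<le> K * d * dist u v"
      by (simp add: Bcontfun_inverse P dist_norm) (simp add: P_def algebra_simps)
  qed
  then obtain u where "Bcontfun (P u) = u"
    using banach_fix_type[of "K * d" "\<lambda>u. Bcontfun (P u)"] assms by auto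
  then have u: "apply_bcontfun u t = P u t" for t by (metis Bcontfun_inverse P)
  show thesis
  proof (rule that[of "apply_bcontfun u"])
    show "apply_bcontfun u 0 = x0" using \<tau>_eq[of 0] \<open>0 < d\<close> by (simp add: u P_def)
    fix t assume t: "t \<in> {-d..d}"
    have "((\<lambda>t. x0 + (F u t - F u 0)) has_vector_derivative 0 + (g (apply_bcontfun u t) - 0)) (at t within {-d..d})"
      by (intro has_vector_derivative_add has_vector_derivative_diff has_vector_derivative_const F t)
    then have "((\<lambda>t. x0 + (F u t - F u 0)) has_vector_derivative g (apply_bcontfun u t)) (at t within {-d..d})"
      by simp
    then show "(apply_bcontfun u has_vector_derivative g (apply_bcontfun u t)) (at t within {-d..d})"
      by (rule has_vector_derivative_transform[OF t, rotated]) (simp add: u P_def \<tau>_eq)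
  qed
qed

text \<open>Compactness of the ball bounds the partial derivatives, their sum over the basis bounds
  the operator norm, and convexity allows the mean value inequality.\<close>

lemma smooth_on_lipschitz_cball:
  fixes f :: "'e::euclidean_space \<Rightarrow> 'f::real_normed_vector"
  assumes "smooth_on f U" "cball x0 r \<subseteq> U"
  obtains K where "0 \<le> K"
    "\<And>x y. x \<in> cball x0 r \<Longrightarrow> y \<in> cball x0 r \<Longrightarrow> dist (f x) (f y) \<le> K * dist x y"
proof -
  have "\<exists>C. \<forall>x\<in>cball x0 r. norm (Dat f x b) \<le> C" for b
  proof -
    have "continuous_on (cball x0 r) (\<lambda>x. Dat f x b)"
      using smooth_on_continuous_on[OF smooth_on_derivative[OF assms(1)]] assms(2)
      by (rule continuous_on_subset)
    then have "bounded ((\<lambda>x. Dat f x b) ` cball x0 r)"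
      by (intro compact_imp_bounded compact_continuous_image) auto
    then show ?thesis by (auto simp: bounded_iff)
  qed
  then obtain C where C: "\<And>b x. x \<in> cball x0 r \<Longrightarrow> norm (Dat f x b) \<le> C b" by metis
  \<comment> \<open>Absolute values, since the sign of \<open>C b\<close> is unknown if the ball is
    empty.\<close>
  define K where "K = (\<Sum>b\<in>Basis. \<bar>C b\<bar>)"
  show thesis
  proof (rule that[of K])
    show "0 \<le> K" by (simp add: K_def sum_nonneg)
    fix x y assume xy: "x \<in> cball x0 r" "y \<in> cball x0 r"
    have "norm (f x - f y) \<le> K * norm (x - y)"
    proof (rule differentiable_bound[OF convex_cball _ _ xy])
      fix z assume z: "z \<in> cball x0 r"
      then have d: "(f has_derivative Dat f z) (at z)"
        using assms by (intro smooth_on_has_derivative) auto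
      then show "(f has_derivative Dat f z) (at z within cball x0 r)"
        by (rule has_derivative_at_withinI)
      show "onorm (Dat f z) \<le> K"
      proof (rule onorm_le)
        fix v
        have "norm (Dat f z v) = norm (\<Sum>b\<in>Basis. (v \<bullet> b) *\<^sub>R Dat f z b)"
          using linear_Basis_expand[OF has_derivative_linear[OF d]] by metis
        also have "\<dots> \<le> (\<Sum>b\<in>Basis. \<bar>C b\<bar> * norm v)"
        proof (rule sum_norm_le)
          fix b :: 'e assume "b \<in> Basis"
          then have "\<bar>v \<bullet> b\<bar> \<le> norm v" by (rule Basis_le_norm)
          moreover have "norm (Dat f z b) \<le> \<bar>C b\<bar>" using C[OF z, of b] by linarith
          ultimately show "norm ((v \<bullet> b) *\<^sub>R Dat f z b) \<le> \<bar>C b\<bar> * norm v"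
            by (simp add: mult.commute mult_mono)
        qed
        finally show "norm (Dat f z v) \<le> K * norm v" by (simp add: K_def sum_distrib_right)
      qed
    qed
    then show "dist (f x) (f y) \<le> K * dist x y" by (simp add: dist_norm)
  qed
qed

text \<open>Composing \<open>f\<close> with the nearest-point retraction onto a closed ball gives a
  globally Lipschitz field \<open>g\<close>. A solution for \<open>g\<close> stays in the ball for a
  short time, and there \<open>g\<close> coincides with \<open>f\<close>.\<close>

theorem picard_lindeloef:
  fixes f :: "'e::euclidean_space \<Rightarrow> 'e"
  assumes "open U" "smooth_on f U" "x0 \<in> U"
  obtains d u where "0 < d" "u 0 = x0" "\<And>t. t \<in> {-d<..<d} \<Longrightarrow> u t \<in> U"
    "\<And>t. t \<in> {-d<..<d} \<Longrightarrow> (u has_vector_derivative f (u t)) (at t)"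
proof -
  obtain r where r: "0 < r" "cball x0 r \<subseteq> U" using assms(1,3) open_contains_cball by blast
  obtain K where K: "0 \<le> K"
    "\<And>x y. x \<in> cball x0 r \<Longrightarrow> y \<in> cball x0 r \<Longrightarrow> dist (f x) (f y) \<le> K * dist x y"
    using smooth_on_lipschitz_cball[OF assms(2) r(2)] by blast
  define g where "g = f \<circ> closest_point (cball x0 r)"
  have in_ball: "closest_point (cball x0 r) x \<in> cball x0 r" for x
    using r(1) by (intro closest_point_in_set) auto
  have lip: "dist (g x) (g y) \<le> K * dist x y" for x y
  proof -
    have "dist (g x) (g y) \<le> K * dist (closest_point (cball x0 r) x) (closest_point (cball x0 r) y)"
      unfolding g_def comp_def by (intro K in_ball)
    also have "\<dots> \<le> K * dist x y"
      using r(1) by (intro mult_left_mono closest_point_lipschitz K(1)) auto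
    finally show ?thesis .
  qed
  have "continuous_on (cball x0 r) f"
    using smooth_on_continuous_on[OF assms(2)] r(2) by (rule continuous_on_subset)
  then have "bounded (f ` cball x0 r)" by (intro compact_imp_bounded compact_continuous_image) auto
  then obtain M where M: "0 < M" "\<And>x. x \<in> cball x0 r \<Longrightarrow> norm (f x) \<le> M"
    by (auto simp: bounded_pos)
  \<comment> \<open>The first bound keeps a curve of speed at most \<open>M\<close> in the ball of
    radius \<open>r\<close>; the second makes \<open>K * d < 1\<close>, with \<open>K + 1\<close>
    because \<open>K\<close> may be 0.\<close>
  define d where "d = min (r / M) (1 / (K + 1))"
  have d: "0 < d" "M * d \<le> r" "K * d < 1"
  proof -
    show "0 < d" using r(1) M(1) K(1) by (auto simp: d_def)
    have "d \<le> r / M" "d \<le> 1 / (K + 1)" by (auto simp: d_def)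
    then show "M * d \<le> r" using M(1) by (simp add: field_simps)
    from \<open>d \<le> 1 / (K + 1)\<close> have "(K + 1) * d \<le> 1" using K(1) by (simp add: field_simps)
    then show "K * d < 1" using \<open>0 < d\<close> by (simp add: algebra_simps)
  qed
  obtain u where u: "u 0 = x0"
    "\<And>t. t \<in> {-d..d} \<Longrightarrow> (u has_vector_derivative g (u t)) (at t within {-d..d})"
    using lipschitz_ODE_solution[OF lip K(1) d(1,3)] by blast
  have ball: "u t \<in> cball x0 r" if t: "t \<in> {-d..d}" for t
  proof -
    have "norm (u t - u 0) \<le> M * \<bar>t - 0\<bar>"
      by (rule lipschitz_from_derivative[OF u(2)]) (use t d(1) M(2) in_ball in \<open>auto simp: g_def\<close>)
    also have "\<dots> \<le> M * d" using t M(1) by (intro mult_left_mono) auto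
    finally show ?thesis using d(2) u(1) by (simp add: dist_norm norm_minus_commute)
  qed
  show thesis
  proof (rule that[of d u])
    show "0 < d" "u 0 = x0" by fact+
    fix t assume t: "t \<in> {-d<..<d}"
    then have tc: "t \<in> {-d..d}" by auto
    show "u t \<in> U" using ball[OF tc] r(2) by blast
    have "(u has_vector_derivative g (u t)) (at t)"
      using u(2)[OF tc] t by (metis at_within_interior interior_atLeastAtMost_real)
    then show "(u has_vector_derivative f (u t)) (at t)"
      using ball[OF tc] by (simp add: g_def closest_point_self)
  qed
qed

text \<open>Bootstrapping: if \<open>u\<close> is of class C^k, so is its derivative
  \<open>f \<circ> u\<close>, hence \<open>u\<close> is of class C^(k+1).\<close>

lemma smooth_on_ODE_solution:
  fixes f :: "'e::euclidean_space \<Rightarrow> 'e"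
  assumes "open U" "smooth_on f U" "open J" "u ` J \<subseteq> U"
    and u: "\<And>t. t \<in> J \<Longrightarrow> (u has_vector_derivative f (u t)) (at t)"
  shows "smooth_on u J"
  unfolding smooth_on_def
proof
  fix k
  show "Ck_on k u J"
  proof (induction k)
    case 0
    show ?case
      using u by (auto intro!: continuous_at_imp_continuous_on dest: has_vector_derivative_continuous)
  next
    case (Suc k)
    have "Ck_on k (\<lambda>t. f (u t)) J"
      using assms(2) by (intro Ck_on_compose[OF assms(3,1,4) _ Suc]) (simp add: smooth_on_def)
    then show ?case
      using u by (intro Ck_on_SucI[OF assms(3), of u "\<lambda>t s. s *\<^sub>R f (u t)"]
          Ck_on_bilinear[OF bounded_bilinear_scaleR assms(3)] Ck_on_const)
        (auto simp: has_vector_derivative_def)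
  qed
qed

section \<open>Charts and the chain rule\<close>

lemma charts_atD: "c \<in> charts_at A p \<Longrightarrow> c \<in> A" "c \<in> charts_at A p \<Longrightarrow> p \<in> cdom c"
  by (auto simp: charts_at_def)

lemma chart_at_in: "p \<in> points A \<Longrightarrow> chart_at A p \<in> charts_at A p"
  unfolding chart_at_def by (rule someI_ex) (auto simp: points_def charts_at_def)

lemma charts_at_points: "c \<in> charts_at A p \<Longrightarrow> p \<in> points A"
  by (auto simp: points_def charts_at_def)

lemma smooth_atlas_inj: "smooth_atlas A \<Longrightarrow> c \<in> A \<Longrightarrow> inj_on (cmap c) (cdom c)"
  by (simp add: smooth_atlas_def)

lemma smooth_atlas_open: "smooth_atlas A \<Longrightarrow> c \<in> A \<Longrightarrow> open (cmap c ` cdom c)"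
  by (simp add: smooth_atlas_def)

lemma cinv_cmap: "inj_on (cmap c) (cdom c) \<Longrightarrow> p \<in> cdom c \<Longrightarrow> cinv c (cmap c p) = p"
  unfolding cinv_def by (rule inv_into_f_f)

lemma cmap_cinv: "x \<in> cmap c ` cdom c \<Longrightarrow> cmap c (cinv c x) = x"
  unfolding cinv_def by (rule f_inv_into_f)

lemma cinv_in: "x \<in> cmap c ` cdom c \<Longrightarrow> cinv c x \<in> cdom c"
  unfolding cinv_def by (rule inv_into_into)

lemma smooth_map_differentiable:
  assumes "smooth_map A B F" "c \<in> charts_at A p" "d \<in> charts_at B (F p)"
  shows "(cmap d \<circ> F \<circ> cinv c) differentiable at (cmap c p)"
proof (rule smooth_on_differentiable)
  show "smooth_on (cmap d \<circ> F \<circ> cinv c) (cmap c ` (cdom c \<inter> F -` cdom d))"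
    using assms by (auto simp: smooth_map_def charts_at_def)
  show "cmap c p \<in> cmap c ` (cdom c \<inter> F -` cdom d)"
    using assms by (auto simp: charts_at_def)
qed

lemma smooth_map_point: "smooth_map A B F \<Longrightarrow> p \<in> points A \<Longrightarrow> F p \<in> points B"
  by (auto simp: smooth_map_def)

lemma smooth_map_id: "smooth_atlas A \<Longrightarrow> smooth_map A A id"
  by (auto simp: smooth_map_def smooth_atlas_def)

lemma smooth_map_cong:
  assumes "smooth_atlas A" "smooth_map A B F" "\<And>p. p \<in> points A \<Longrightarrow> F p = G p"
  shows "smooth_map A B G"
  unfolding smooth_map_def
proof (intro conjI ballI)
  show "G ` points A \<subseteq> points B" using assms(2,3) by (auto simp: smooth_map_def)
  fix c d assume c: "c \<in> A" and d: "d \<in> B"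
  have eq: "F p = G p" if "p \<in> cdom c" for p using that c assms(3) by (auto simp: points_def)
  have S: "cdom c \<inter> F -` cdom d = cdom c \<inter> G -` cdom d" using eq by auto
  have F: "open (cmap c ` (cdom c \<inter> F -` cdom d))"
    "smooth_on (cmap d \<circ> F \<circ> cinv c) (cmap c ` (cdom c \<inter> F -` cdom d))"
    using assms(2) c d by (auto simp: smooth_map_def)
  then show "open (cmap c ` (cdom c \<inter> G -` cdom d))" by (simp add: S)
  show "smooth_on (cmap d \<circ> G \<circ> cinv c) (cmap c ` (cdom c \<inter> G -` cdom d))"
    unfolding S[symmetric]
    by (rule smooth_on_cong[OF F(1) _ F(2)])
      (use smooth_atlas_inj[OF assms(1) c] eq in \<open>auto simp: cinv_cmap\<close>)
qed

text \<open>No single chart of \<open>B\<close> need contain the image of the whole domain of the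
  coordinate expression. Around each point an intermediate chart \<open>d\<close> gives an open set
  on which the expression factors; openness and smoothness are then both local.\<close>

lemma smooth_map_compose:
  assumes A: "smooth_atlas A" and B: "smooth_atlas B"
    and F: "smooth_map A B F" and G: "smooth_map B C G"
  shows "smooth_map A C (G \<circ> F)"
  unfolding smooth_map_def
proof (intro conjI ballI)
  show "(G \<circ> F) ` points A \<subseteq> points C"
    using smooth_map_point[OF G smooth_map_point[OF F]] by auto
  fix c e assume c: "c \<in> A" and e: "e \<in> C"
  let ?S = "cmap c ` (cdom c \<inter> (G \<circ> F) -` cdom e)"
  let ?h = "cmap e \<circ> (G \<circ> F) \<circ> cinv c"
  have *: "\<exists>W. open W \<and> x \<in> W \<and> W \<subseteq> ?S \<and> smooth_on ?h W" if x: "x \<in> ?S" for x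
  proof -
    obtain p where p: "p \<in> cdom c" "G (F p) \<in> cdom e" "x = cmap c p" using x by auto
    have "F p \<in> points B" using smooth_map_point[OF F] p(1) c by (auto simp: points_def)
    then obtain d where d: "d \<in> B" "F p \<in> cdom d" by (auto simp: points_def)
    let ?U = "cmap c ` (cdom c \<inter> F -` cdom d)" and ?V = "cmap d ` (cdom d \<inter> G -` cdom e)"
    let ?f = "cmap d \<circ> F \<circ> cinv c" and ?g = "cmap e \<circ> G \<circ> cinv d"
    have U: "open ?U" "smooth_on ?f ?U" and V: "open ?V" "smooth_on ?g ?V"
      using F G c d e by (auto simp: smooth_map_def)
    note inj = smooth_atlas_inj[OF A c] smooth_atlas_inj[OF B d(1)]
    have fU: "?f (cmap c q) = cmap d (F q)" if "q \<in> cdom c" for q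
      using that inj by (simp add: cinv_cmap)
    let ?W = "?U \<inter> ?f -` ?V"
    have o: "open ?W"
      using continuous_open_preimage[OF smooth_on_continuous_on[OF U(2)] U(1) V(1)] .
    \<comment> \<open>Conversely, on \<open>?W\<close> injectivity of the chart \<open>d\<close>
      turns the condition on the coordinates of \<open>F q\<close> back into
      \<open>G (F q) \<in> cdom e\<close>.\<close>
    have x': "x \<in> ?W" using p d fU by auto
    have W: "y \<in> ?S \<and> ?g (?f y) = ?h y" if y: "y \<in> ?W" for y
    proof -
      obtain q where q: "q \<in> cdom c" "F q \<in> cdom d" "y = cmap c q" using y by auto
      have "cmap d (F q) \<in> ?V" using y q fU by auto
      then have "G (F q) \<in> cdom e" using inj(2) q(2) by (auto dest: inj_onD)
      then show ?thesis using q inj by (auto simp: cinv_cmap)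
    qed
    have f: "smooth_on ?f ?W" using U(2) by (rule smooth_on_subset) blast
    have gf: "smooth_on (\<lambda>y. ?g (?f y)) ?W"
      by (rule smooth_on_compose[OF o V(1) _ V(2) f]) blast
    have h: "smooth_on ?h ?W" by (rule smooth_on_cong[OF o conjunct2[OF W] gf])
    have sub: "?W \<subseteq> ?S" using conjunct1[OF W] by (rule subsetI)
    show ?thesis by (intro exI[of _ ?W] conjI o x' sub h)
  qed
  show "open ?S" using * by (subst open_subopen) blast
  show "smooth_on ?h ?S" using * by (intro smooth_on_local) blast
qed

text \<open>\<open>H\<close> takes values in a vector space, so one statement serves for real
  functions, for coordinate maps and for maps followed by a chart of their target.\<close>

lemma chart_chain:
  assumes inj: "inj_on (cmap c) (cdom c)" "inj_on (cmap d) (cdom d)"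
    and p: "p \<in> cdom c" "F p \<in> cdom d" and "open (cmap c ` (cdom c \<inter> F -` cdom d))"
    and F: "(cmap d \<circ> F \<circ> cinv c) differentiable at (cmap c p)"
    and H: "(H \<circ> cinv d) differentiable at (cmap d (F p))"
  shows "((H \<circ> F \<circ> cinv c) has_derivative
    (\<lambda>v. Dat (H \<circ> cinv d) (cmap d (F p)) (Dat (cmap d \<circ> F \<circ> cinv c) (cmap c p) v))) (at (cmap c p))"
proof (rule has_derivative_transform_within_open[OF _ assms(5)])
  have "((H \<circ> cinv d) has_derivative Dat (H \<circ> cinv d) (cmap d (F p))) (at ((cmap d \<circ> F \<circ> cinv c) (cmap c p)))"
    using H inj p by (simp add: cinv_cmap frechet_derivative_works)
  then show "((\<lambda>x. (H \<circ> cinv d) ((cmap d \<circ> F \<circ> cinv c) x)) has_derivative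
    (\<lambda>v. Dat (H \<circ> cinv d) (cmap d (F p)) (Dat (cmap d \<circ> F \<circ> cinv c) (cmap c p) v))) (at (cmap c p))"
    by (rule has_derivative_compose[OF F[unfolded frechet_derivative_works]])
qed (use inj p in \<open>auto simp: cinv_cmap\<close>)

lemma smooth_map_chain:
  assumes "smooth_atlas A" "smooth_atlas B" "smooth_map A B F"
    and "c \<in> charts_at A p" "d \<in> charts_at B (F p)"
    and "(H \<circ> cinv d) differentiable at (cmap d (F p))"
  shows "((H \<circ> F \<circ> cinv c) has_derivative
    (\<lambda>v. Dat (H \<circ> cinv d) (cmap d (F p)) (Dat (cmap d \<circ> F \<circ> cinv c) (cmap c p) v))) (at (cmap c p))"
  using assms
  by (intro chart_chain smooth_atlas_inj smooth_map_differentiable[OF assms(3)])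
    (auto simp: charts_at_def smooth_map_def)

lemma transition_chain:
  assumes "smooth_atlas A" "c \<in> charts_at A p" "d \<in> charts_at A p"
    and "(H \<circ> cinv d) differentiable at (cmap d p)"
  shows "((H \<circ> cinv c) has_derivative
    (\<lambda>v. Dat (H \<circ> cinv d) (cmap d p) (Dat (cmap d \<circ> cinv c) (cmap c p) v))) (at (cmap c p))"
  using smooth_map_chain[OF assms(1,1) smooth_map_id[OF assms(1)] assms(2), of d H] assms(3,4) by simp

lemma transition_differentiable:
  assumes "smooth_atlas A" "c \<in> charts_at A p" "d \<in> charts_at A p"
  shows "(cmap d \<circ> cinv c) differentiable at (cmap c p)"
  using smooth_map_differentiable[OF smooth_map_id[OF assms(1)] assms(2), of d] assms(3) by simp

lemma transition_self:
  assumes "smooth_atlas A" "c \<in> charts_at A p"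
  shows "Dat (cmap c \<circ> cinv c) (cmap c p) = (\<lambda>v. v)"
proof (rule Dat_eqI, rule has_derivative_transform_within_open[OF has_derivative_ident])
  show "open (cmap c ` cdom c)" by (rule smooth_atlas_open[OF assms(1) charts_atD(1)[OF assms(2)]])
qed (use assms in \<open>auto simp: charts_at_def cmap_cinv\<close>)

section \<open>Tangent vectors and differentials in an arbitrary chart\<close>

lemma tangent_space_iff:
  "V \<in> tangent_space A p \<longleftrightarrow> fst V = p \<and> (\<forall>c. c \<notin> charts_at A p \<longrightarrow> snd V c = 0) \<and>
    (\<forall>c\<in>charts_at A p. \<forall>d\<in>charts_at A p. snd V d = Dat (cmap d \<circ> cinv c) (cmap c p) (snd V c))"
  by (cases V) (simp only: tangent_space_def mem_Collect_eq Pair_inject fst_conv snd_conv, blast)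

lemma tangent_spaceD:
  assumes "V \<in> tangent_space A p"
  shows "fst V = p" "c \<notin> charts_at A p \<Longrightarrow> snd V c = 0"
    "c \<in> charts_at A p \<Longrightarrow> d \<in> charts_at A p \<Longrightarrow> snd V d = Dat (cmap d \<circ> cinv c) (cmap c p) (snd V c)"
  using assms[unfolded tangent_space_iff] by blast+

lemma tangent_spaceI:
  assumes "fst V = p" "\<And>c. c \<notin> charts_at A p \<Longrightarrow> snd V c = 0"
    "\<And>c d. c \<in> charts_at A p \<Longrightarrow> d \<in> charts_at A p \<Longrightarrow> snd V d = Dat (cmap d \<circ> cinv c) (cmap c p) (snd V c)"
  shows "V \<in> tangent_space A p"
  using assms unfolding tangent_space_iff by blast

lemma tangent_eqI:
  assumes "V \<in> tangent_space A p" "W \<in> tangent_space A p" "c \<in> charts_at A p" "snd V c = snd W c"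
  shows "V = W"
proof (rule prod_eqI)
  show "fst V = fst W" using assms tangent_spaceD(1) by metis
  show "snd V = snd W"
  proof
    fix d show "snd V d = snd W d"
    proof (cases "d \<in> charts_at A p")
      case True
      show ?thesis
        unfolding tangent_spaceD(3)[OF assms(1,3) True] tangent_spaceD(3)[OF assms(2,3) True] assms(4) ..
    next
      case False
      then show ?thesis using tangent_spaceD(2)[OF assms(1)] tangent_spaceD(2)[OF assms(2)] by simp
    qed
  qed
qed

lemma tangent_of_component:
  "smooth_atlas A \<Longrightarrow> c \<in> charts_at A p \<Longrightarrow> snd (tangent_of A c p u) c = u"
  by (simp add: tangent_of_def transition_self)

text \<open>The transformation law is here the cocycle identity for derivatives of transition maps,
  an instance of the chain rule.\<close>

lemma tangent_of_in:
  assumes "smooth_atlas A" "c \<in> charts_at A p"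
  shows "tangent_of A c p u \<in> tangent_space A p"
proof (rule tangent_spaceI)
  fix d e assume d: "d \<in> charts_at A p" and e: "e \<in> charts_at A p"
  from transition_chain[OF assms d, of "cmap e"] transition_differentiable[OF assms(1) d e]
  have "Dat (cmap e \<circ> cinv c) (cmap c p)
    = (\<lambda>v. Dat (cmap e \<circ> cinv d) (cmap d p) (Dat (cmap d \<circ> cinv c) (cmap c p) v))"
    by (intro Dat_eqI)
  then show "snd (tangent_of A c p u) e = Dat (cmap e \<circ> cinv d) (cmap d p) (snd (tangent_of A c p u) d)"
    using d e by (simp add: tangent_of_def)
qed (auto simp: tangent_of_def)

lemma tangent_points_iff: "V \<in> tangent_points A \<longleftrightarrow> fst V \<in> points A \<and> V \<in> tangent_space A (fst V)"
  by (auto simp: tangent_points_def dest: tangent_spaceD(1))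

lemma smooth_fun_differentiable:
  assumes "smooth_fun A f" "c \<in> charts_at A p"
  shows "(f \<circ> cinv c) differentiable at (cmap c p)"
  by (rule smooth_on_differentiable[of _ "cmap c ` cdom c"])
    (use assms in \<open>auto simp: smooth_fun_def charts_at_def\<close>)

text \<open>Removes the arbitrary \<open>chart_at\<close>: derivatives of \<open>f\<close> in two
  charts differ by the same transition derivative that relates the components of
  \<open>V\<close>.\<close>

lemma differential_chart:
  assumes "smooth_atlas A" "smooth_fun A f" "V \<in> tangent_space A p" "c \<in> charts_at A p"
  shows "differential A f V = Dat (f \<circ> cinv c) (cmap c p) (snd V c)"
proof -
  let ?c = "chart_at A p"
  have c': "?c \<in> charts_at A p" by (rule chart_at_in[OF charts_at_points[OF assms(4)]])
  have "Dat (f \<circ> cinv c) (cmap c p) = (\<lambda>v. Dat (f \<circ> cinv ?c) (cmap ?c p) (Dat (cmap ?c \<circ> cinv c) (cmap c p) v))"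
    by (intro Dat_eqI transition_chain[OF assms(1,4) c'] smooth_fun_differentiable[OF assms(2) c'])
  then show ?thesis
    using tangent_spaceD(1)[OF assms(3)] tangent_spaceD(3)[OF assms(3,4) c'] by (simp add: differential_def Let_def)
qed

section \<open>Tangent maps and their functoriality\<close>

lemma tangent_map_fst: "fst (tangent_map A B F V) = F (fst V)"
  by (simp add: tangent_map_def Let_def)

lemma tangent_map_chart:
  assumes "smooth_atlas A" "smooth_map A B F" "V \<in> tangent_space A p"
    and "c \<in> charts_at A p" "d \<in> charts_at B (F p)"
  shows "snd (tangent_map A B F V) d = Dat (cmap d \<circ> F \<circ> cinv c) (cmap c p) (snd V c)"
proof -
  let ?c = "chart_at A p"
  have c': "?c \<in> charts_at A p" by (rule chart_at_in[OF charts_at_points[OF assms(4)]])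
  have "Dat (cmap d \<circ> F \<circ> cinv c) (cmap c p) =
    (\<lambda>v. Dat (cmap d \<circ> F \<circ> cinv ?c) (cmap ?c p) (Dat (cmap ?c \<circ> cinv c) (cmap c p) v))"
    by (intro Dat_eqI transition_chain[OF assms(1,4) c'] smooth_map_differentiable[OF assms(2) c' assms(5)])
  then show ?thesis
    using tangent_spaceD(1)[OF assms(3)] tangent_spaceD(3)[OF assms(3,4) c'] assms(5)
    by (simp add: tangent_map_def Let_def)
qed

lemma tangent_map_in:
  assumes "smooth_atlas A" "smooth_atlas B" "smooth_map A B F" "p \<in> points A" "V \<in> tangent_space A p"
  shows "tangent_map A B F V \<in> tangent_space B (F p)"
proof (rule tangent_spaceI)
  have V: "fst V = p" using tangent_spaceD(1)[OF assms(5)] .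
  then show "fst (tangent_map A B F V) = F p" by (simp add: tangent_map_fst)
  show "snd (tangent_map A B F V) c = 0" if "c \<notin> charts_at B (F p)" for c
    using that V by (simp add: tangent_map_def Let_def)
  fix d e assume d: "d \<in> charts_at B (F p)" and e: "e \<in> charts_at B (F p)"
  let ?c = "chart_at A p"
  have c: "?c \<in> charts_at A p" by (rule chart_at_in[OF assms(4)])
  have "Dat (cmap e \<circ> F \<circ> cinv ?c) (cmap ?c p) =
    (\<lambda>v. Dat (cmap e \<circ> cinv d) (cmap d (F p)) (Dat (cmap d \<circ> F \<circ> cinv ?c) (cmap ?c p) v))"
    by (intro Dat_eqI smooth_map_chain[OF assms(1-3) c d] transition_differentiable[OF assms(2) d e])
  then show "snd (tangent_map A B F V) e
      = Dat (cmap e \<circ> cinv d) (cmap d (F p)) (snd (tangent_map A B F V) d)"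
    by (simp add: tangent_map_chart[OF assms(1,3,5) c] d e)
qed

lemma tangent_map_compose:
  assumes "smooth_atlas A" "smooth_atlas B" "smooth_atlas C" "smooth_map A B F" "smooth_map B C G"
    and "p \<in> points A" "V \<in> tangent_space A p"
  shows "tangent_map B C G (tangent_map A B F V) = tangent_map A C (G \<circ> F) V"
proof -
  note GF = smooth_map_compose[OF assms(1,2,4,5)]
  let ?c = "chart_at A p" and ?d = "chart_at B (F p)" and ?e = "chart_at C ((G \<circ> F) p)"
  have c: "?c \<in> charts_at A p" by (rule chart_at_in[OF assms(6)])
  have F: "F p \<in> points B" by (rule smooth_map_point[OF assms(4,6)])
  have d: "?d \<in> charts_at B (F p)" by (rule chart_at_in[OF F])
  have e: "?e \<in> charts_at C ((G \<circ> F) p)" by (rule chart_at_in[OF smooth_map_point[OF GF assms(6)]])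
  then have e': "?e \<in> charts_at C (G (F p))" by simp
  note W = tangent_map_in[OF assms(1,2,4,6,7)]
  show ?thesis
  proof (rule tangent_eqI[OF _ _ e])
    show "tangent_map B C G (tangent_map A B F V) \<in> tangent_space C ((G \<circ> F) p)"
      using tangent_map_in[OF assms(2,3,5) F W] by simp
    show "tangent_map A C (G \<circ> F) V \<in> tangent_space C ((G \<circ> F) p)"
      by (rule tangent_map_in[OF assms(1,3) GF assms(6,7)])
    have "Dat (cmap ?e \<circ> G \<circ> F \<circ> cinv ?c) (cmap ?c p) = (\<lambda>v. Dat (cmap ?e \<circ> G \<circ> cinv ?d) (cmap ?d (F p))
        (Dat (cmap ?d \<circ> F \<circ> cinv ?c) (cmap ?c p) v))"
      using smooth_map_differentiable[OF assms(5) d e']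
      by (intro Dat_eqI smooth_map_chain[OF assms(1,2,4) c d])
    then have D: "Dat (cmap ?e \<circ> (G \<circ> F) \<circ> cinv ?c) (cmap ?c p) (snd V ?c) =
        Dat (cmap ?e \<circ> G \<circ> cinv ?d) (cmap ?d (F p)) (Dat (cmap ?d \<circ> F \<circ> cinv ?c) (cmap ?c p) (snd V ?c))"
      by (simp only: comp_assoc)
    show "snd (tangent_map B C G (tangent_map A B F V)) ?e = snd (tangent_map A C (G \<circ> F) V) ?e"
      unfolding tangent_map_chart[OF assms(2,5) W d e'] tangent_map_chart[OF assms(1,4,7) c d]
        tangent_map_chart[OF assms(1) GF assms(7) c e] D ..
  qed
qed

text \<open>Formulated for maps that are the identity on \<open>points A\<close> only, in order to
  apply to \<open>fst \<circ> X\<close>, whose values elsewhere are arbitrary.\<close>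

lemma tangent_map_identity:
  assumes "smooth_atlas A" "\<And>q. q \<in> points A \<Longrightarrow> F q = q" "p \<in> points A" "V \<in> tangent_space A p"
  shows "tangent_map A A F V = V"
proof -
  have F: "smooth_map A A F"
    by (rule smooth_map_cong[OF assms(1) smooth_map_id[OF assms(1)]]) (simp add: assms(2))
  let ?c = "chart_at A p"
  have c: "?c \<in> charts_at A p" by (rule chart_at_in[OF assms(3)])
  have "Dat (cmap ?c \<circ> F \<circ> cinv ?c) (cmap ?c p) = (\<lambda>v. v)"
  proof (rule Dat_eqI, rule has_derivative_transform_within_open[OF has_derivative_ident])
    show "open (cmap ?c ` cdom ?c)" by (rule smooth_atlas_open[OF assms(1) charts_atD(1)[OF c]])
    show "x = (cmap ?c \<circ> F \<circ> cinv ?c) x" if "x \<in> cmap ?c ` cdom ?c" for x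
    proof -
      have "cinv ?c x \<in> points A" using cinv_in[OF that] charts_atD(1)[OF c] by (auto simp: points_def)
      then show ?thesis using cmap_cinv[OF that] assms(2) by simp
    qed
  qed (use c in \<open>auto simp: charts_at_def\<close>)
  moreover have "?c \<in> charts_at A (F p)" using c assms(2,3) by simp
  ultimately show ?thesis
    using tangent_map_in[OF assms(1,1) F assms(3,4)] assms(2)[OF assms(3)]
    by (intro tangent_eqI[OF _ assms(4) c]) (auto simp: tangent_map_chart[OF assms(1) F assms(4) c])
qed

lemma differential_compose:
  assumes "smooth_atlas A" "smooth_atlas B" "smooth_map A B F" "smooth_fun B f"
    and "p \<in> points A" "V \<in> tangent_space A p"
  shows "differential B f (tangent_map A B F V) = differential A (f \<circ> F) V"
proof -
  let ?c = "chart_at A p" and ?d = "chart_at B (F p)"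
  have c: "?c \<in> charts_at A p" by (rule chart_at_in[OF assms(5)])
  have d: "?d \<in> charts_at B (F p)" by (rule chart_at_in[OF smooth_map_point[OF assms(3,5)]])
  have "Dat (f \<circ> F \<circ> cinv ?c) (cmap ?c p) = (\<lambda>v. Dat (f \<circ> cinv ?d) (cmap ?d (F p))
        (Dat (cmap ?d \<circ> F \<circ> cinv ?c) (cmap ?c p) v))"
    by (intro Dat_eqI smooth_map_chain[OF assms(1-3) c d] smooth_fun_differentiable[OF assms(4) d])
  then show ?thesis
    using differential_chart[OF assms(2,4) tangent_map_in[OF assms(1,2,3,5,6)] d]
      tangent_map_chart[OF assms(1,3,6) c d] tangent_spaceD(1)[OF assms(6)]
    by (simp add: differential_def Let_def)
qed

section \<open>Curves\<close>

lemma smooth_atlas_interval: "open I \<Longrightarrow> smooth_atlas {(I, \<lambda>t::real. t)}"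
  by (auto simp: smooth_atlas_def cinv_def intro!: smooth_on_cong[OF _ _ smooth_on_bounded_linear[OF bounded_linear_ident]])

lemma cinv_interval: "t \<in> I \<Longrightarrow> cinv (I, \<lambda>t. t) t = t"
  using cinv_cmap[of "(I, \<lambda>t. t)" t] by simp

lemma smooth_curve_open: "smooth_curve A I \<gamma> \<Longrightarrow> open I"
  by (simp add: smooth_curve_def)

lemma smooth_curve_compose:
  assumes "smooth_atlas A" "smooth_map A B F" "smooth_curve A I \<gamma>"
  shows "smooth_curve B I (F \<circ> \<gamma>)"
  using assms smooth_map_compose[OF smooth_atlas_interval, of I A \<gamma> B F] by (auto simp: smooth_curve_def)

lemma smooth_curve_point: "smooth_curve A I \<gamma> \<Longrightarrow> t \<in> I \<Longrightarrow> \<gamma> t \<in> points A"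
  by (auto simp: smooth_curve_def smooth_map_def points_def)

text \<open>Velocities are defined by \<open>vector_derivative\<close> directly, while smoothness of
  a curve is stated through the inverse of the interval chart, which is the identity on
  \<open>I\<close> only. This lemma bridges the two.\<close>

lemma curve_chain:
  assumes "smooth_atlas A" "smooth_curve A I \<gamma>" "t \<in> I" "c \<in> charts_at A (\<gamma> t)"
    and H: "(H \<circ> cinv c) differentiable at (cmap c (\<gamma> t))"
  shows "((H \<circ> \<gamma>) has_vector_derivative
    Dat (H \<circ> cinv c) (cmap c (\<gamma> t)) (vector_derivative (cmap c \<circ> \<gamma>) (at t))) (at t)"
proof -
  let ?S = "I \<inter> \<gamma> -` cdom c"
  have c: "c \<in> A" "\<gamma> t \<in> cdom c" using assms(4) by (auto simp: charts_at_def)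
  note inj = smooth_atlas_inj[OF assms(1) c(1)]
  have S: "open ?S" "smooth_on (cmap c \<circ> \<gamma> \<circ> cinv (I, \<lambda>t. t)) ?S"
    using assms(2) c(1) by (auto simp: smooth_curve_def smooth_map_def)
  have "smooth_on (cmap c \<circ> \<gamma>) ?S"
    by (rule smooth_on_cong[OF S(1) _ S(2)]) (simp add: cinv_interval)
  then have "(cmap c \<circ> \<gamma>) differentiable at t"
    by (rule smooth_on_differentiable) (use assms(3) c(2) in auto)
  then have g: "((cmap c \<circ> \<gamma>) has_derivative (\<lambda>s. s *\<^sub>R vector_derivative (cmap c \<circ> \<gamma>) (at t))) (at t)"
    by (simp add: vector_derivative_works has_vector_derivative_def)
  have H': "((H \<circ> cinv c) has_derivative Dat (H \<circ> cinv c) (cmap c (\<gamma> t))) (at ((cmap c \<circ> \<gamma>) t))"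
    using H by (simp add: frechet_derivative_works)
  have "((\<lambda>s. (H \<circ> cinv c) ((cmap c \<circ> \<gamma>) s)) has_derivative (\<lambda>s. s *\<^sub>R
      Dat (H \<circ> cinv c) (cmap c (\<gamma> t)) (vector_derivative (cmap c \<circ> \<gamma>) (at t)))) (at t)"
    using has_derivative_compose[OF g H'] linear_cmul[OF has_derivative_linear[OF H']] by simp
  then have "((H \<circ> \<gamma>) has_derivative (\<lambda>s. s *\<^sub>R
      Dat (H \<circ> cinv c) (cmap c (\<gamma> t)) (vector_derivative (cmap c \<circ> \<gamma>) (at t)))) (at t)"
    by (rule has_derivative_transform_within_open[OF _ S(1)])
      (use assms(3) c(2) inj in \<open>auto simp: cinv_cmap\<close>)
  then show ?thesis by (simp add: has_vector_derivative_def)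
qed

lemma velocity_in:
  assumes "smooth_atlas A" "smooth_curve A I \<gamma>" "t \<in> I"
  shows "velocity A \<gamma> t \<in> tangent_space A (\<gamma> t)"
proof (rule tangent_spaceI)
  fix c d assume c: "c \<in> charts_at A (\<gamma> t)" and d: "d \<in> charts_at A (\<gamma> t)"
  show "snd (velocity A \<gamma> t) d = Dat (cmap d \<circ> cinv c) (cmap c (\<gamma> t)) (snd (velocity A \<gamma> t) c)"
    using vector_derivative_at[OF curve_chain[OF assms c transition_differentiable[OF assms(1) c d]]] c d
    by (simp add: velocity_def)
qed (auto simp: velocity_def)

lemma velocity_compose:
  assumes "smooth_atlas A" "smooth_map A B F" "smooth_curve A I \<gamma>" "t \<in> I"
  shows "velocity B (F \<circ> \<gamma>) t = tangent_map A B F (velocity A \<gamma> t)"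
proof -
  let ?c = "chart_at A (\<gamma> t)"
  have c: "?c \<in> charts_at A (\<gamma> t)" by (rule chart_at_in[OF smooth_curve_point[OF assms(3,4)]])
  have "vector_derivative (cmap d \<circ> F \<circ> \<gamma>) (at t)
      = Dat (cmap d \<circ> F \<circ> cinv ?c) (cmap ?c (\<gamma> t)) (vector_derivative (cmap ?c \<circ> \<gamma>) (at t))"
    if "d \<in> charts_at B (F (\<gamma> t))" for d
    by (intro vector_derivative_at curve_chain[OF assms(1,3,4) c] smooth_map_differentiable[OF assms(2) c that])
  then show ?thesis using c by (auto simp: velocity_def tangent_map_def Let_def comp_assoc)
qed

text \<open>Curves are total functions with arbitrary values outside \<open>I\<close>. This is what
  permits exchanging a curve in Im X for \<open>X \<circ> \<gamma>\<close>, with which it agrees on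
  \<open>I\<close> only.\<close>

lemma velocity_cong:
  assumes "open I" "t \<in> I" "\<And>s. s \<in> I \<Longrightarrow> \<gamma> s = \<delta> s"
  shows "velocity A \<gamma> t = velocity A \<delta> t"
proof -
  have "vector_derivative (cmap c \<circ> \<gamma>) (at t) = vector_derivative (cmap c \<circ> \<delta>) (at t)" for c :: "('a, 'b) chart"
    using assms by (intro vector_derivative_cong_eq) (auto simp: eventually_nhds)
  then show ?thesis unfolding velocity_def using assms(2,3) by presburger
qed

section \<open>The tangent bundle\<close>

lemma cmap_natural_chart [simp]: "cmap (natural_chart A c) V = (cmap c (fst V), snd V c)"
  and cdom_natural_chart [simp]: "cdom (natural_chart A c) = {V \<in> tangent_points A. fst V \<in> cdom c}"
  by (auto simp: natural_chart_def)

lemma points_tangent_bundle: "points (tangent_bundle A) = tangent_points A"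
proof -
  have "points (tangent_bundle A) = {V \<in> tangent_points A. fst V \<in> points A}"
    unfolding points_def tangent_bundle_def by auto
  then show ?thesis using tangent_points_iff[of _ A] by blast
qed

lemma charts_at_tangent_bundle:
  "w \<in> tangent_points A \<Longrightarrow> charts_at (tangent_bundle A) w = natural_chart A ` charts_at A (fst w)"
  by (auto simp: charts_at_def tangent_bundle_def)

lemma tangent_points_fst: "w \<in> tangent_points A \<Longrightarrow> fst w \<in> points A"
  by (simp add: tangent_points_iff)

lemma tangent_of_fst [simp]: "fst (tangent_of A c p u) = p"
  by (simp add: tangent_of_def)

lemma tangent_of_points:
  assumes "smooth_atlas A" "c \<in> charts_at A p"
  shows "tangent_of A c p u \<in> tangent_points A"
  using tangent_of_in[OF assms] charts_at_points[OF assms(2)] by (simp add: tangent_points_iff)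

lemma natural_chart_inj:
  assumes "smooth_atlas A" "c \<in> A"
  shows "inj_on (cmap (natural_chart A c)) (cdom (natural_chart A c))"
proof (rule inj_onI)
  fix V W assume V: "V \<in> cdom (natural_chart A c)" and W: "W \<in> cdom (natural_chart A c)"
    and eq: "cmap (natural_chart A c) V = cmap (natural_chart A c) W"
  have "fst V = fst W"
    using V W eq by (intro inj_onD[OF smooth_atlas_inj[OF assms]]) auto
  then show "V = W"
    using V W eq assms(2) by (intro tangent_eqI[of V A "fst V" W c]) (auto simp: tangent_points_iff charts_at_def)
qed

text \<open>Every fibre is hit completely, by the vectors \<open>tangent_of A c p v\<close>. With
  \<open>S\<close> the domain of a second chart this identifies chart overlaps in the tangent bundle
  as open products.\<close>

lemma natural_chart_image:
  assumes "smooth_atlas A" "c \<in> A"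
  shows "cmap (natural_chart A c) ` {V \<in> cdom (natural_chart A c). fst V \<in> S}
    = cmap c ` (cdom c \<inter> S) \<times> UNIV" (is "?L = ?R")
proof
  show "?L \<subseteq> ?R" by auto
  show "?R \<subseteq> ?L"
  proof clarify
    fix p v assume p: "p \<in> cdom c" "p \<in> S"
    then have c: "c \<in> charts_at A p" using assms(2) by (simp add: charts_at_def)
    show "(cmap c p, v) \<in> ?L"
      by (rule image_eqI[of _ _ "tangent_of A c p v"])
        (use p tangent_of_points[OF assms(1) c] tangent_of_component[OF assms(1) c] in auto)
  qed
qed

lemma natural_chart_range:
  assumes "smooth_atlas A" "c \<in> A"
  shows "cmap (natural_chart A c) ` cdom (natural_chart A c) = cmap c ` cdom c \<times> UNIV"
  using natural_chart_image[OF assms, of UNIV] by simp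

lemma cinv_natural_chart:
  assumes "smooth_atlas A" "c \<in> A" "p \<in> cdom c"
  shows "cinv (natural_chart A c) (cmap c p, v) = tangent_of A c p v"
proof -
  have c: "c \<in> charts_at A p" using assms(2,3) by (simp add: charts_at_def)
  show ?thesis
    using cinv_cmap[OF natural_chart_inj[OF assms(1,2)], of "tangent_of A c p v"] assms(3)
      tangent_of_points[OF assms(1) c] tangent_of_component[OF assms(1) c]
    by simp
qed

lemma natural_transition:
  assumes "smooth_atlas A" "c \<in> charts_at A p" "d \<in> charts_at A p"
  shows "cmap (natural_chart A d) (cinv (natural_chart A c) (cmap c p, v))
    = (cmap d p, Dat (cmap d \<circ> cinv c) (cmap c p) v)"
  using cinv_natural_chart[OF assms(1), of c p v] assms(2,3) by (simp add: charts_at_def tangent_of_def)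

text \<open>This is the coordinate form of the tangent lift of \<open>\<phi>\<close>. The direction
  \<open>snd z\<close> is a variable, so the derivative is expanded over the basis before smoothness
  is read off.\<close>

lemma smooth_on_natural_transition:
  fixes \<phi> :: "'e::euclidean_space \<Rightarrow> 'f::euclidean_space"
  assumes "open S" "smooth_on \<phi> S"
  shows "smooth_on (\<lambda>z. (\<phi> (fst z), Dat \<phi> (fst z) (snd z))) (S \<times> UNIV)"
proof (rule smooth_on_Pair)
  show o: "open (S \<times> (UNIV :: 'e set))" by (intro open_Times assms) simp
  have fst: "smooth_on (\<lambda>z. \<psi> (fst z)) (S \<times> (UNIV :: 'e set))" if "smooth_on \<psi> S" for \<psi> :: "'e \<Rightarrow> 'f"
    by (rule smooth_on_compose[OF o assms(1) _ that smooth_on_bounded_linear[OF bounded_linear_fst]]) auto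
  show "smooth_on (\<lambda>z. \<phi> (fst z)) (S \<times> (UNIV :: 'e set))" by (rule fst[OF assms(2)])
  have "smooth_on (\<lambda>z. \<Sum>b\<in>Basis. (snd z \<bullet> b) *\<^sub>R Dat \<phi> (fst z) b) (S \<times> UNIV)"
    by (intro smooth_on_sum o finite_Basis smooth_on_bilinear[OF bounded_bilinear_scaleR]
        smooth_on_bilinear[OF bounded_bilinear_inner] smooth_on_const fst smooth_on_derivative
        assms(2) smooth_on_bounded_linear[OF bounded_linear_snd])
  then show "smooth_on (\<lambda>z. Dat \<phi> (fst z) (snd z)) (S \<times> UNIV)"
  proof (rule smooth_on_cong[OF o, rotated])
    fix z :: "'e \<times> 'e" assume "z \<in> S \<times> UNIV"
    then have "linear (Dat \<phi> (fst z))"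
      by (intro has_derivative_linear[OF smooth_on_has_derivative[OF assms(2)]]) auto
    then show "(\<Sum>b\<in>Basis. (snd z \<bullet> b) *\<^sub>R Dat \<phi> (fst z) b) = Dat \<phi> (fst z) (snd z)"
      by (metis linear_Basis_expand)
  qed
qed

lemma smooth_atlas_tangent_bundle:
  assumes "smooth_atlas A"
  shows "smooth_atlas (tangent_bundle A)"
proof -
  have "inj_on (cmap (natural_chart A c)) (cdom (natural_chart A c))"
    "open (cmap (natural_chart A c) ` cdom (natural_chart A c))" if c: "c \<in> A" for c
    using natural_chart_inj[OF assms c] smooth_atlas_open[OF assms c]
    by (simp_all only: natural_chart_range[OF assms c] open_Times open_UNIV)
  moreover have "open (cmap (natural_chart A c) ` (cdom (natural_chart A c) \<inter> cdom (natural_chart A d)))"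
    (is "open (_ ` ?S)")
    "smooth_on (cmap (natural_chart A d) \<circ> cinv (natural_chart A c))
      (cmap (natural_chart A c) ` (cdom (natural_chart A c) \<inter> cdom (natural_chart A d)))"
    if c: "c \<in> A" and d: "d \<in> A" for c d
  proof -
    let ?T = "cmap c ` (cdom c \<inter> cdom d)"
    have "?S = {V \<in> cdom (natural_chart A c). fst V \<in> cdom d}" by auto
    then have S: "cmap (natural_chart A c) ` ?S = ?T \<times> UNIV"
      using natural_chart_image[OF assms c] by simp
    have T: "open ?T" "smooth_on (cmap d \<circ> cinv c) ?T"
      using assms c d by (auto simp: smooth_atlas_def)
    have o: "open (?T \<times> UNIV)" by (intro open_Times T open_UNIV)
    then show "open (cmap (natural_chart A c) ` ?S)" by (simp only: S)
    show "smooth_on (cmap (natural_chart A d) \<circ> cinv (natural_chart A c)) (cmap (natural_chart A c) ` ?S)"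
      unfolding S
    proof (rule smooth_on_cong[OF o _ smooth_on_natural_transition[OF T]])
      fix z assume "z \<in> ?T \<times> (UNIV :: 'b set)"
      then obtain p v where z: "z = (cmap c p, v)" "p \<in> cdom c" "p \<in> cdom d" by auto
      have "c \<in> charts_at A p" "d \<in> charts_at A p" using z c d by (auto simp: charts_at_def)
      from natural_transition[OF assms this, of v]
      show "((cmap d \<circ> cinv c) (fst z), Dat (cmap d \<circ> cinv c) (fst z) (snd z))
        = (cmap (natural_chart A d) \<circ> cinv (natural_chart A c)) z"
        using z cinv_cmap[OF smooth_atlas_inj[OF assms c]] by simp
    qed
  qed
  ultimately show ?thesis
    unfolding smooth_atlas_def tangent_bundle_def by blast
qed

lemma smooth_map_fst:
  assumes "smooth_atlas A"
  shows "smooth_map (tangent_bundle A) A fst"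
  unfolding smooth_map_def
proof (intro conjI ballI)
  show "fst ` points (tangent_bundle A) \<subseteq> points A"
    by (auto simp: points_tangent_bundle intro: tangent_points_fst)
  fix N d assume "N \<in> tangent_bundle A" and d: "d \<in> A"
  then obtain c where c: "c \<in> A" and N: "N = natural_chart A c" by (auto simp: tangent_bundle_def)
  let ?T = "cmap c ` (cdom c \<inter> cdom d)"
  have "cdom N \<inter> fst -` cdom d = {V \<in> cdom (natural_chart A c). fst V \<in> cdom d}"
    by (auto simp: N)
  then have S: "cmap N ` (cdom N \<inter> fst -` cdom d) = ?T \<times> UNIV"
    using natural_chart_image[OF assms c] by (simp add: N)
  have T: "open ?T" "smooth_on (cmap d \<circ> cinv c) ?T"
    using assms c d by (auto simp: smooth_atlas_def)
  have o: "open (?T \<times> (UNIV :: 'b set))" by (intro open_Times T open_UNIV)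
  then show "open (cmap N ` (cdom N \<inter> fst -` cdom d))" by (simp only: S)
  have "smooth_on (\<lambda>z. (cmap d \<circ> cinv c) (fst z)) (?T \<times> (UNIV :: 'b set))"
    by (rule smooth_on_compose[OF o T(1) _ T(2) smooth_on_bounded_linear[OF bounded_linear_fst]]) auto
  then show "smooth_on (cmap d \<circ> fst \<circ> cinv N) (cmap N ` (cdom N \<inter> fst -` cdom d))"
    unfolding S
  proof (rule smooth_on_cong[OF o, rotated])
    fix z assume "z \<in> ?T \<times> (UNIV :: 'b set)"
    then obtain p v where z: "z = (cmap c p, v)" "p \<in> cdom c" by auto
    show "(cmap d \<circ> cinv c) (fst z) = (cmap d \<circ> fst \<circ> cinv N) z"
      using z cinv_natural_chart[OF assms c z(2), of v] cinv_cmap[OF smooth_atlas_inj[OF assms c] z(2)] by (simp add: N)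
  qed
qed

lemma tangent_map_fst_chart:
  assumes "smooth_atlas A" "w \<in> tangent_points A" "V \<in> tangent_space (tangent_bundle A) w"
    and "c \<in> charts_at A (fst w)"
  shows "snd (tangent_map (tangent_bundle A) A fst V) c = fst (snd V (natural_chart A c))"
proof -
  have c: "c \<in> A" using assms(4) by (rule charts_atD)
  have N: "natural_chart A c \<in> charts_at (tangent_bundle A) w"
    using assms(2,4) by (simp add: charts_at_tangent_bundle)
  have "Dat (cmap c \<circ> fst \<circ> cinv (natural_chart A c)) (cmap (natural_chart A c) w) = fst"
  proof (rule Dat_eqI, rule has_derivative_transform_within_open[OF has_derivative_fst[OF has_derivative_ident]])
    show "open (cmap c ` cdom c \<times> (UNIV :: 'b set))"
      by (intro open_Times smooth_atlas_open[OF assms(1) c] open_UNIV)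
    show "cmap (natural_chart A c) w \<in> cmap c ` cdom c \<times> UNIV" using charts_atD(2)[OF assms(4)] by simp
    show "fst z = (cmap c \<circ> fst \<circ> cinv (natural_chart A c)) z"
      if "z \<in> cmap c ` cdom c \<times> (UNIV :: 'b set)" for z
      using that cinv_natural_chart[OF assms(1) c] by auto
  qed
  then show ?thesis
    using tangent_map_chart[OF smooth_atlas_tangent_bundle[OF assms(1)] smooth_map_fst[OF assms(1)] assms(3) N assms(4)]
    by simp
qed

text \<open>The fibre coordinates transform linearly, so fibre derivatives transform like vectors.\<close>

lemma vertical_derivative:
  fixes H :: "('a, 'e::euclidean_space) tangent \<Rightarrow> 'g::real_normed_vector"
  assumes A: "smooth_atlas A" and w: "w \<in> tangent_points A"
    and c: "c \<in> charts_at A (fst w)" and d: "d \<in> charts_at A (fst w)"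
    and Hc: "(H \<circ> cinv (natural_chart A c)) differentiable at (cmap (natural_chart A c) w)"
    and Hd: "(H \<circ> cinv (natural_chart A d)) differentiable at (cmap (natural_chart A d) w)"
  shows "Dat (H \<circ> cinv (natural_chart A c)) (cmap (natural_chart A c) w) (0, a) =
    Dat (H \<circ> cinv (natural_chart A d)) (cmap (natural_chart A d) w)
      (0, Dat (cmap d \<circ> cinv c) (cmap c (fst w)) a)"
proof -
  let ?B = "Dat (cmap d \<circ> cinv c) (cmap c (fst w))"
  let ?hc = "H \<circ> cinv (natural_chart A c)" and ?hd = "H \<circ> cinv (natural_chart A d)"
  have W: "w \<in> tangent_space A (fst w)" using w by (simp add: tangent_points_iff)
  have "(cmap d \<circ> cinv c has_derivative ?B) (at (cmap c (fst w)))"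
    using transition_differentiable[OF A c d] by (simp add: frechet_derivative_works)
  then have B: "bounded_linear ?B" by (rule has_derivative_bounded_linear)
  have w_d: "?B (snd w c) = snd w d" using tangent_spaceD(3)[OF W c d] by simp
  have hc: "(?hc has_derivative Dat ?hc (cmap c (fst w), snd w c)) (at (cmap c (fst w), snd w c))"
    using Hc unfolding frechet_derivative_works by (simp only: cmap_natural_chart)
  have hd: "(?hd has_derivative Dat ?hd (cmap d (fst w), snd w d)) (at (cmap d (fst w), ?B (snd w c)))"
    using Hd unfolding frechet_derivative_works w_d by (simp only: cmap_natural_chart)
  have "((\<lambda>u. ?hc (cmap c (fst w), u)) has_derivative
      (\<lambda>a. Dat ?hc (cmap c (fst w), snd w c) (0, a))) (at (snd w c))"
    by (rule has_derivative_compose[of "\<lambda>u. (cmap c (fst w), u)" "\<lambda>a. (0, a)" "snd w c" UNIV ?hc, OF _ hc])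
      (intro has_derivative_Pair has_derivative_const has_derivative_ident)
  moreover have "((\<lambda>u. ?hd (cmap d (fst w), ?B u)) has_derivative
      (\<lambda>a. Dat ?hd (cmap d (fst w), snd w d) (0, ?B a))) (at (snd w c))"
    by (rule has_derivative_compose[of "\<lambda>u. (cmap d (fst w), ?B u)" "\<lambda>a. (0, ?B a)" "snd w c" UNIV ?hd, OF _ hd])
      (intro has_derivative_Pair has_derivative_const bounded_linear_imp_has_derivative B)
  \<comment> \<open>With the base point frozen, the change of fibre coordinates is the constant
    linear map \<open>?B\<close>, so no second derivatives of the transition map arise. The two
    sides are the same function of \<open>u\<close>, and uniqueness of its derivative at
    \<open>snd w c\<close> finishes.\<close>
  moreover have "?hc (cmap c (fst w), u) = ?hd (cmap d (fst w), ?B u)" for u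
  proof -
    let ?T = "tangent_of A c (fst w) u"
    have "?T \<in> cdom (natural_chart A d)"
      using tangent_of_points[OF A c] charts_atD(2)[OF d] by simp
    then have "cinv (natural_chart A d) (cmap (natural_chart A d) ?T) = ?T"
      by (rule cinv_cmap[OF natural_chart_inj[OF A charts_atD(1)[OF d]]])
    then show ?thesis
      using cinv_natural_chart[OF A charts_atD[OF c]] d by (simp add: tangent_of_def)
  qed
  ultimately have "(\<lambda>a. Dat ?hc (cmap c (fst w), snd w c) (0, a)) =
      (\<lambda>a. Dat ?hd (cmap d (fst w), snd w d) (0, ?B a))"
    by (metis (no_types, lifting) ext has_derivative_unique)
  then show ?thesis unfolding cmap_natural_chart by (rule fun_cong)
qed

section \<open>The Lagrange equation in natural coordinates\<close>

text \<open>The projection T\<tau>(V) transforms as a vector on Q and the fibre derivative of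
  \<open>L\<close> as a covector, so their pairing is the same in every natural chart.\<close>

lemma theta_chart:
  assumes A: "smooth_atlas A" and L: "smooth_fun (tangent_bundle A) L"
    and w: "w \<in> tangent_points A" and V: "V \<in> tangent_space (tangent_bundle A) w"
    and c: "c \<in> charts_at A (fst w)"
  shows "theta A L V = Dat (L \<circ> cinv (natural_chart A c)) (cmap (natural_chart A c) w)
    (0, fst (snd V (natural_chart A c)))"
proof -
  let ?d = "chart_at A (fst w)"
  let ?N = "natural_chart A ?d"
  have d: "?d \<in> charts_at A (fst w)" by (rule chart_at_in[OF tangent_points_fst[OF w]])
  have diff: "(L \<circ> cinv (natural_chart A e)) differentiable at (cmap (natural_chart A e) w)"
    if "e \<in> charts_at A (fst w)" for e
    by (rule smooth_fun_differentiable[OF L]) (use that w in \<open>simp add: charts_at_tangent_bundle\<close>)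
  let ?l = "\<lambda>a. Dat (L \<circ> cinv ?N) (cmap ?N w) (0, a)"
  have lin: "linear ?l"
    using has_derivative_linear[OF diff[OF d, unfolded frechet_derivative_works]]
    by (rule linear_Pair_zero)
  have Vw: "fst V = w" by (rule tangent_spaceD(1)[OF V])
  have T: "tangent_map (tangent_bundle A) A fst V \<in> tangent_space A (fst w)"
    by (rule tangent_map_in[OF smooth_atlas_tangent_bundle[OF A] A smooth_map_fst[OF A] _ V])
      (simp add: points_tangent_bundle w)
  have "theta A L V = ?l (fst (snd V ?N))"
    unfolding linear_Basis_expand[OF lin, of "fst (snd V ?N)"]
    by (simp add: theta_def Let_def Vw mult.commute)
  also have "fst (snd V ?N) = Dat (cmap ?d \<circ> cinv c) (cmap c (fst w)) (fst (snd V (natural_chart A c)))"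
    using tangent_spaceD(3)[OF T c d] tangent_map_fst_chart[OF A w V c] tangent_map_fst_chart[OF A w V d]
    by simp
  also have "?l \<dots> = Dat (L \<circ> cinv (natural_chart A c)) (cmap (natural_chart A c) w)
      (0, fst (snd V (natural_chart A c)))"
    by (rule vertical_derivative[OF A w c d diff[OF c] diff[OF d], symmetric])
  finally show ?thesis .
qed

lemma liouville_in:
  assumes A: "smooth_atlas A" and w: "w \<in> tangent_points A"
  shows "liouville A w \<in> tangent_space (tangent_bundle A) w"
proof (rule tangent_spaceI)
  fix N M assume N: "N \<in> charts_at (tangent_bundle A) w" and M: "M \<in> charts_at (tangent_bundle A) w"
  then obtain c d where c: "c \<in> charts_at A (fst w)" "N = natural_chart A c"
    and d: "d \<in> charts_at A (fst w)" "M = natural_chart A d"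
    using charts_at_tangent_bundle[OF w] by auto
  note TA = smooth_atlas_tangent_bundle[OF A]
  \<comment> \<open>\<open>vertical_derivative\<close> is applied to the coordinate map
    \<open>cmap M\<close> itself: a vertical vector (0, a) becomes (0, Ba), with B the transition
    derivative on Q.\<close>
  have "Dat (cmap M \<circ> cinv N) (cmap N w) (0, snd w c)
      = Dat (cmap M \<circ> cinv M) (cmap M w) (0, Dat (cmap d \<circ> cinv c) (cmap c (fst w)) (snd w c))"
    using vertical_derivative[OF A w c(1) d(1), of "cmap M"]
      transition_differentiable[OF TA N M] transition_differentiable[OF TA M M]
    by (simp only: c(2) d(2))
  also have "\<dots> = (0, snd w d)"
    using tangent_spaceD(3)[OF _ c(1) d(1), of w] w transition_self[OF TA M]
    by (simp add: tangent_points_iff)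
  finally show "snd (liouville A w) M = Dat (cmap M \<circ> cinv N) (cmap N w) (snd (liouville A w) N)"
    using N M by (simp add: liouville_def c(2) d(2))
qed (auto simp: liouville_def)

lemma energy_chart:
  assumes A: "smooth_atlas A" and L: "smooth_fun (tangent_bundle A) L"
    and w: "w \<in> tangent_points A" and c: "c \<in> charts_at A (fst w)"
  shows "energy A L w =
    Dat (L \<circ> cinv (natural_chart A c)) (cmap (natural_chart A c) w) (0, snd w c) - L w"
proof -
  have N: "natural_chart A c \<in> charts_at (tangent_bundle A) w"
    using w c by (simp add: charts_at_tangent_bundle)
  show ?thesis
    using differential_chart[OF smooth_atlas_tangent_bundle[OF A] L liouville_in[OF A w] N] N
    by (simp add: energy_def liouville_def)
qed

text \<open>Written as a sum over the basis so that only derivatives of \<open>l\<close> in constant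
  directions occur; both the smoothness of the energy and its differential are computed from this
  form.\<close>

lemma energy_natural_chart:
  assumes A: "smooth_atlas A" and L: "smooth_fun (tangent_bundle A) L" and c: "c \<in> A"
    and z: "z \<in> cmap c ` cdom c \<times> UNIV"
  defines "l \<equiv> L \<circ> cinv (natural_chart A c)"
  shows "(energy A L \<circ> cinv (natural_chart A c)) z = (\<Sum>b\<in>Basis. (snd z \<bullet> b) *\<^sub>R Dat l z (0, b)) - l z"
proof -
  obtain p v where p: "p \<in> cdom c" and zp: "z = (cmap c p, v)" using z by auto
  then have cp: "c \<in> charts_at A p" using c by (simp add: charts_at_def)
  let ?w = "tangent_of A c p v"
  have w: "cinv (natural_chart A c) z = ?w" by (simp add: zp cinv_natural_chart[OF A c p])
  have z': "cmap (natural_chart A c) ?w = z" by (simp add: zp tangent_of_component[OF A cp])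
  have "l differentiable at z"
    using smooth_fun_differentiable[OF L, of "natural_chart A c" ?w] tangent_of_points[OF A cp] p c z'
    by (simp add: charts_at_tangent_bundle cp l_def)
  then have "linear (Dat l z)" by (rule linear_frechet_derivative)
  then have lin: "linear (\<lambda>a. Dat l z (0, a))"
    by (rule linear_Pair_zero)
  have "energy A L ?w = Dat l z (0, v) - L ?w"
    using energy_chart[OF A L tangent_of_points[OF A cp], of c v] cp tangent_of_component[OF A cp] z'
    by (simp add: l_def)
  also have "Dat l z (0, v) = (\<Sum>b\<in>Basis. (snd z \<bullet> b) *\<^sub>R Dat l z (0, b))"
    using linear_Basis_expand[OF lin, of v] by (simp add: zp)
  finally show ?thesis by (simp add: w l_def)
qed

lemma smooth_fun_energy:
  assumes A: "smooth_atlas A" and L: "smooth_fun (tangent_bundle A) L"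
  shows "smooth_fun (tangent_bundle A) (energy A L)"
  unfolding smooth_fun_def
proof
  fix N assume "N \<in> tangent_bundle A"
  then obtain c where c: "c \<in> A" and N: "N = natural_chart A c" by (auto simp: tangent_bundle_def)
  let ?U = "cmap c ` cdom c \<times> (UNIV :: 'b set)"
  have U: "cmap N ` cdom N = ?U" using natural_chart_range[OF A c] by (simp only: N)
  have o: "open ?U" by (intro open_Times smooth_atlas_open[OF A c] open_UNIV)
  have l: "smooth_on (L \<circ> cinv N) ?U"
    using L c unfolding smooth_fun_def tangent_bundle_def U[symmetric] N by blast
  show "smooth_on (energy A L \<circ> cinv N) (cmap N ` cdom N)"
    unfolding U
  proof (rule smooth_on_cong[OF o])
    show "smooth_on (\<lambda>z. (\<Sum>b\<in>Basis. (snd z \<bullet> b) *\<^sub>R Dat (L \<circ> cinv N) z (0, b)) - (L \<circ> cinv N) z) ?U"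
      by (intro smooth_on_diff o smooth_on_sum finite_Basis smooth_on_bilinear[OF bounded_bilinear_scaleR]
          smooth_on_bilinear[OF bounded_bilinear_inner] smooth_on_const smooth_on_derivative l
          smooth_on_bounded_linear[OF bounded_linear_snd])
    show "(\<Sum>b\<in>Basis. (snd z \<bullet> b) *\<^sub>R Dat (L \<circ> cinv N) z (0, b)) - (L \<circ> cinv N) z
      = (energy A L \<circ> cinv N) z" if "z \<in> ?U" for z
      using energy_natural_chart[OF A L c that] by (simp add: N)
  qed
qed

text \<open>If \<open>V\<close> is a second order vector at \<open>w\<close>, the terms with derivatives of \<open>\<partial>L/\<partial>v\<close> along \<open>W\<close> cancel in
  \<open>i(V)\<omega>\<^sub>L - dE\<^sub>L\<close>, and so do the vertical components of \<open>W\<close>: this 1-form is semibasic.\<close>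

lemma lagrange_form_semibasic:
  fixes A :: "('a, 'e::euclidean_space) atlas"
  assumes A: "smooth_atlas A" and L: "smooth_fun (tangent_bundle A) L"
    and w: "w \<in> tangent_points A" and V: "V \<in> tangent_space (tangent_bundle A) w"
    and sode: "tangent_map (tangent_bundle A) A fst V = w"
  obtains h where "\<And>W. W \<in> tangent_space (tangent_bundle A) w \<Longrightarrow>
    omega A L V W - differential (tangent_bundle A) (energy A L) W
      = h (tangent_map (tangent_bundle A) A fst W)"
proof -
  let ?TA = "tangent_bundle A"
  note TA = smooth_atlas_tangent_bundle[OF A]
  define N where "N = chart_at ?TA w"
  have "w \<in> points ?TA" using w by (simp only: points_tangent_bundle)
  then have N: "N \<in> charts_at ?TA w" unfolding N_def by (rule chart_at_in)
  then obtain c where c: "c \<in> charts_at A (fst w)" and Nc: "N = natural_chart A c"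
    using charts_at_tangent_bundle[OF w] by auto
  have cA: "c \<in> A" using c by (rule charts_atD)
  define l where "l = L \<circ> cinv N"
  \<comment> \<open>\<open>G a\<close> is the coefficient function of \<theta>_L in the base
    direction \<open>a\<close>, that is, the fibre derivative of \<open>L\<close> along
    \<open>a\<close>.\<close>
  define G where "G a x = Dat l x (0, a)" for a x
  define z where "z = cmap N w"
  let ?U = "cmap c ` cdom c \<times> (UNIV :: 'e set)"
  have o: "open ?U" by (intro open_Times smooth_atlas_open[OF A cA] open_UNIV)
  have range: "cmap N ` cdom N = ?U" unfolding Nc by (rule natural_chart_range[OF A cA])
  have z: "z \<in> ?U" unfolding z_def range[symmetric] using charts_atD(2)[OF N] by (rule imageI)
  have l: "smooth_on l ?U"
    using L charts_atD(1)[OF N] unfolding smooth_fun_def l_def range[symmetric] by blast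
  have G: "(G a has_derivative Dat (G a) z) (at z)" for a
    unfolding G_def by (rule smooth_on_has_derivative[OF smooth_on_derivative[OF l] z])
  have lz: "(l has_derivative Dat l z) (at z)" by (rule smooth_on_has_derivative[OF l z])
  have G_lin: "linear (\<lambda>a. G a x)" if "x \<in> ?U" for x
    unfolding G_def using has_derivative_linear[OF smooth_on_has_derivative[OF l that]]
    by (rule linear_Pair_zero)
  \<comment> \<open>Although \<open>theta\<close> chooses a chart anew at each point, on a field
    with constant components \<open>u\<close> it equals \<open>G (fst u)\<close> throughout the one
    chart \<open>N\<close>.\<close>
  have theta: "Dat (\<lambda>x. theta A L (tangent_of ?TA N (cinv N x) u)) z = Dat (G (fst u)) z" for u
  proof (rule Dat_eqI, rule has_derivative_transform_within_open[OF G o z])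
    fix x assume "x \<in> ?U"
    then have x: "x \<in> cmap N ` cdom N" by (simp only: range)
    let ?w = "cinv N x"
    have w': "?w \<in> cdom N" by (rule cinv_in[OF x])
    then have wt: "?w \<in> tangent_points A" and c': "c \<in> charts_at A (fst ?w)"
      using cA by (auto simp: Nc charts_at_def)
    then have N': "N \<in> charts_at ?TA ?w" unfolding charts_at_def using charts_atD(1)[OF N] w' by blast
    have "theta A L (tangent_of ?TA N ?w u)
        = Dat l (cmap N ?w) (0, fst (snd (tangent_of ?TA N ?w u) N))"
      using theta_chart[OF A L wt tangent_of_in[OF TA N'] c'] by (simp only: l_def Nc)
    also have "\<dots> = G (fst u) x"
      using tangent_of_component[OF TA N'] cmap_cinv[OF x] by (simp only: G_def)
    finally show "G (fst u) x = theta A L (tangent_of ?TA N (cinv N x) u)" ..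
  qed
  have Vw: "fst V = w" by (rule tangent_spaceD(1)[OF V])
  define V' where "V' = snd V N"
  have "fst V' = snd w c"
    using tangent_map_fst_chart[OF A w V c] unfolding sode V'_def Nc ..
  also have "\<dots> = snd z" by (simp add: z_def Nc)
  \<comment> \<open>The second order condition in coordinates: the base component of
    \<open>V\<close> is the fibre coordinate of \<open>w\<close>.\<close>
  finally have V': "fst V' = snd z" .
  have "omega A L V W - differential ?TA (energy A L) W = Dat l z (a, 0) - Dat (G a) z V'"
    if W: "W \<in> tangent_space ?TA w" and a: "a = snd (tangent_map ?TA A fst W) c" for W a
  proof -
    define W' where "W' = snd W N"
    have a': "a = fst W'" unfolding a W'_def Nc by (rule tangent_map_fst_chart[OF A w W c])
    \<comment> \<open>The minus sign in \<omega>_L = -d\<theta>_L puts the derivative along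
      \<open>W\<close> first. The direction \<open>snd z\<close> is frozen here, whereas in the
      energy the fibre coordinate varies; this accounts for the extra term
      \<open>G (snd W') z\<close> below.\<close>
    have om: "omega A L V W = Dat (G (snd z)) z W' - Dat (G a) z V'"
      by (simp add: omega_def ext_derivative_def Let_def Vw theta flip: N_def z_def V'_def W'_def)
        (simp add: V' a')
    have E: "((\<lambda>x. (\<Sum>b\<in>Basis. (snd x \<bullet> b) *\<^sub>R G b x) - l x) has_derivative
        (\<lambda>h. (\<Sum>b\<in>Basis. (snd z \<bullet> b) *\<^sub>R Dat (G b) z h + (snd h \<bullet> b) *\<^sub>R G b z) - Dat l z h)) (at z)"
      by (intro has_derivative_diff has_derivative_sum has_derivative_scaleR G lz
          has_derivative_inner_left has_derivative_snd has_derivative_ident)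
    have "((energy A L \<circ> cinv N) has_derivative
        (\<lambda>h. (\<Sum>b\<in>Basis. (snd z \<bullet> b) *\<^sub>R Dat (G b) z h + (snd h \<bullet> b) *\<^sub>R G b z) - Dat l z h)) (at z)"
    proof (rule has_derivative_transform_within_open[OF E o z])
      fix x assume "x \<in> ?U"
      from energy_natural_chart[OF A L cA this]
      show "(\<Sum>b\<in>Basis. (snd x \<bullet> b) *\<^sub>R G b x) - l x = (energy A L \<circ> cinv N) x"
        by (simp add: l_def G_def Nc)
    qed
    then have "differential ?TA (energy A L) W =
        (\<Sum>b\<in>Basis. (snd z \<bullet> b) *\<^sub>R Dat (G b) z W' + (snd W' \<bullet> b) *\<^sub>R G b z) - Dat l z W'"
      unfolding differential_chart[OF TA smooth_fun_energy[OF A L] W N] z_def[symmetric] W'_def[symmetric]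
      by (rule Dat_eqI[THEN fun_cong])
    also have "\<dots> = Dat (G (snd z)) z W' + G (snd W') z - Dat l z W'"
    proof -
      \<comment> \<open>Linearity of \<open>G\<close> in its direction is known on the chart image
        only, so it is passed to the derivative through agreement on this open set.\<close>
      have "((\<lambda>x. \<Sum>b\<in>Basis. (snd z \<bullet> b) *\<^sub>R G b x) has_derivative
          (\<lambda>h. \<Sum>b\<in>Basis. (snd z \<bullet> b) *\<^sub>R Dat (G b) z h)) (at z)"
        by (intro has_derivative_sum has_derivative_scaleR_right G)
      then have "(G (snd z) has_derivative (\<lambda>h. \<Sum>b\<in>Basis. (snd z \<bullet> b) *\<^sub>R Dat (G b) z h)) (at z)"
        by (rule has_derivative_transform_within_open[OF _ o z])
          (rule linear_Basis_expand[OF G_lin, symmetric])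
      then have "Dat (G (snd z)) z = (\<lambda>h. \<Sum>b\<in>Basis. (snd z \<bullet> b) *\<^sub>R Dat (G b) z h)"
        by (rule Dat_eqI)
      moreover have "G (snd W') z = (\<Sum>b\<in>Basis. (snd W' \<bullet> b) *\<^sub>R G b z)"
        by (rule linear_Basis_expand[OF G_lin[OF z]])
      ultimately show ?thesis by (simp only: sum.distrib)
    qed
    \<comment> \<open>Splitting off the vertical part of \<open>W'\<close> produces a second
      \<open>G (snd W') z\<close>, which cancels the one from the energy.\<close>
    also have "Dat l z W' = Dat l z (a, 0) + G (snd W') z"
      using linear_add[OF has_derivative_linear[OF lz], of "(a, 0)" "(0, snd W')"]
      by (simp add: a' G_def)
    finally show ?thesis by (simp add: om)
  qed
  then show thesis
    \<comment> \<open>The witness is the Euler-Lagrange expression dL/dq - V(dL/dv), paired with the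
      base component of \<open>W\<close>.\<close>
    by (intro that[of "\<lambda>u. Dat l z (snd u c, 0) - Dat (G (snd u c)) z V'"]) blast
qed

section \<open>Integral curves\<close>

lemma vector_field_in:
  assumes "vector_field A X" "p \<in> points A"
  shows "X p \<in> tangent_space A p"
proof -
  have "X p \<in> tangent_points A" "fst (X p) = p"
    using assms smooth_map_point[of A "tangent_bundle A" X p] by (auto simp: vector_field_def points_tangent_bundle)
  then show ?thesis by (metis tangent_points_iff)
qed

lemma vector_field_components_smooth:
  assumes A: "smooth_atlas A" and X: "vector_field A X" and c: "c \<in> A"
  shows "smooth_on (\<lambda>x. snd (X (cinv c x)) c) (cmap c ` cdom c)"
proof -
  let ?N = "natural_chart A c"
  have "natural_chart A c \<in> tangent_bundle A" using c by (simp add: tangent_bundle_def)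
  then have "smooth_on (cmap ?N \<circ> X \<circ> cinv c) (cmap c ` (cdom c \<inter> X -` cdom ?N))"
    using X c unfolding vector_field_def smooth_map_def by blast
  moreover have "p \<in> X -` cdom ?N" if "p \<in> cdom c" for p
  proof -
    have p: "p \<in> points A" using that c by (auto simp: points_def)
    then have "X p \<in> tangent_points A"
      using X smooth_map_point[of A "tangent_bundle A" X p] by (auto simp: vector_field_def points_tangent_bundle)
    then show ?thesis using X p that by (simp add: vector_field_def)
  qed
  then have "cdom c \<inter> X -` cdom ?N = cdom c" by blast
  ultimately have "smooth_on (cmap ?N \<circ> X \<circ> cinv c) (cmap c ` cdom c)" by simp
  then have "smooth_on (\<lambda>x. snd ((cmap ?N \<circ> X \<circ> cinv c) x)) (cmap c ` cdom c)"
    by (rule smooth_on_compose[OF smooth_atlas_open[OF A c] open_UNIV subset_UNIV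
          smooth_on_bounded_linear[OF bounded_linear_snd]])
  then show ?thesis by simp
qed

text \<open>A coordinate curve in one chart must be tested against all charts of the atlas; it
  enters the others through the transition maps, on the open preimage of the overlap.\<close>

lemma smooth_curve_cinv:
  assumes A: "smooth_atlas A" and c: "c \<in> A" and J: "open J" "is_interval J"
    and u: "smooth_on u J" "u ` J \<subseteq> cmap c ` cdom c"
  shows "smooth_curve A J (cinv c \<circ> u)"
  unfolding smooth_curve_def smooth_map_def
proof (intro conjI J ballI)
  let ?\<gamma> = "cinv c \<circ> u"
  have dom: "?\<gamma> t \<in> cdom c" if "t \<in> J" for t
    using that u(2) cinv_in[of "u t" c] by auto
  then show "?\<gamma> ` points {(J, \<lambda>t. t)} \<subseteq> points A" using c by (auto simp: points_def)
  fix i d assume "i \<in> {(J, \<lambda>t::real. t)}" and d: "d \<in> A"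
  then have i: "i = (J, \<lambda>t. t)" by simp
  let ?T = "cmap c ` (cdom c \<inter> cdom d)"
  have T: "open ?T" "smooth_on (cmap d \<circ> cinv c) ?T"
    using A c d by (auto simp: smooth_atlas_def)
  have "t \<in> ?\<gamma> -` cdom d \<longleftrightarrow> u t \<in> ?T" if t: "t \<in> J" for t
  proof
    assume "t \<in> ?\<gamma> -` cdom d"
    then show "u t \<in> ?T"
      using dom[OF t] cmap_cinv[of "u t" c] u(2) t by (intro image_eqI[of _ _ "?\<gamma> t"]) auto
  next
    assume "u t \<in> ?T"
    then obtain p where "p \<in> cdom c" "p \<in> cdom d" "u t = cmap c p" by auto
    then show "t \<in> ?\<gamma> -` cdom d" by (simp add: cinv_cmap[OF smooth_atlas_inj[OF A c]])
  qed
  then have "J \<inter> ?\<gamma> -` cdom d = J \<inter> u -` ?T" by blast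
  then have S: "cmap i ` (cdom i \<inter> ?\<gamma> -` cdom d) = J \<inter> u -` ?T" by (simp add: i)
  have o: "open (J \<inter> u -` ?T)"
    by (rule continuous_open_preimage[OF smooth_on_continuous_on[OF u(1)] J(1) T(1)])
  then show "open (cmap i ` (cdom i \<inter> ?\<gamma> -` cdom d))" by (simp only: S)
  show "smooth_on (cmap d \<circ> ?\<gamma> \<circ> cinv i) (cmap i ` (cdom i \<inter> ?\<gamma> -` cdom d))"
    unfolding S
  proof (rule smooth_on_cong[OF o])
    have "smooth_on u (J \<inter> u -` ?T)" using u(1) by (rule smooth_on_subset) blast
    from smooth_on_compose[OF o T(1) _ T(2) this]
    show "smooth_on (\<lambda>t. (cmap d \<circ> cinv c) (u t)) (J \<inter> u -` ?T)" by blast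
    show "(cmap d \<circ> cinv c) (u t) = (cmap d \<circ> ?\<gamma> \<circ> cinv i) t" if "t \<in> J \<inter> u -` ?T" for t
      using that by (simp add: i cinv_interval)
  qed
qed

text \<open>The ODE is solved for the components of \<open>X\<close> in one chart. Agreement of
  velocity and field in that chart suffices, since one component determines a tangent
  vector.\<close>

lemma integral_curve_exists:
  assumes A: "smooth_atlas A" and X: "vector_field A X" and p: "p \<in> points A"
  obtains I \<gamma> where "0 \<in> I" "integral_curve A X I \<gamma>" "\<gamma> 0 = p"
proof -
  let ?c = "chart_at A p"
  have cp: "?c \<in> charts_at A p" by (rule chart_at_in[OF p])
  have c: "?c \<in> A" "p \<in> cdom ?c" by (rule charts_atD[OF cp])+
  let ?U = "cmap ?c ` cdom ?c" and ?f = "\<lambda>x. snd (X (cinv ?c x)) ?c"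
  have U: "open ?U" by (rule smooth_atlas_open[OF A c(1)])
  have f: "smooth_on ?f ?U" by (rule vector_field_components_smooth[OF A X c(1)])
  obtain r u where r: "0 < r" and u: "u 0 = cmap ?c p"
    "\<And>t. t \<in> {-r<..<r} \<Longrightarrow> u t \<in> ?U" "\<And>t. t \<in> {-r<..<r} \<Longrightarrow> (u has_vector_derivative ?f (u t)) (at t)"
    using picard_lindeloef[OF U f imageI[OF c(2)]] by metis
  let ?J = "{-r<..<r}" and ?\<gamma> = "cinv ?c \<circ> u"
  have uU: "u ` ?J \<subseteq> ?U" using u(2) by (rule image_subsetI)
  have "smooth_on u ?J"
    by (rule smooth_on_ODE_solution[OF U f open_greaterThanLessThan uU u(3)])
  then have \<gamma>: "smooth_curve A ?J ?\<gamma>"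
    by (rule smooth_curve_cinv[OF A c(1) open_greaterThanLessThan is_interval_oo _ uU])
  have "velocity A ?\<gamma> t = X (?\<gamma> t)" if t: "t \<in> ?J" for t
  proof (rule tangent_eqI)
    show "velocity A ?\<gamma> t \<in> tangent_space A (?\<gamma> t)" by (rule velocity_in[OF A \<gamma> t])
    show "X (?\<gamma> t) \<in> tangent_space A (?\<gamma> t)"
      by (rule vector_field_in[OF X smooth_curve_point[OF \<gamma> t]])
    have "?\<gamma> t \<in> cdom ?c" using cinv_in[OF u(2)[OF t]] by simp
    then show ct: "?c \<in> charts_at A (?\<gamma> t)" using c(1) by (simp add: charts_at_def)
    have "((cmap ?c \<circ> ?\<gamma>) has_vector_derivative ?f (u t)) (at t)"
      by (rule has_vector_derivative_transform_within_open[OF u(3)[OF t] open_greaterThanLessThan t])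
        (simp add: cmap_cinv[OF u(2)])
    then show "snd (velocity A ?\<gamma> t) ?c = snd (X (?\<gamma> t)) ?c"
      using ct by (simp add: velocity_def vector_derivative_at)
  qed
  then have "integral_curve A X ?J ?\<gamma>" using \<gamma> by (simp add: integral_curve_def)
  then show thesis
    using that[of ?J ?\<gamma>] r u(1) cinv_cmap[OF smooth_atlas_inj[OF A c(1)] c(2)] by simp
qed

section \<open>Equivalence of the five conditions\<close>

theorem theorem4:
  fixes Q :: "('a, real ^ 'n) atlas"
    and L :: "('a, real ^ 'n) tangent \<Rightarrow> real"
    and X :: "'a \<Rightarrow> ('a, real ^ 'n) tangent"
  assumes "smooth_manifold Q"
    and "smooth_fun (tangent_bundle Q) L"
    and "\<exists>r. \<forall>w\<in>points (tangent_bundle Q).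
           tangent_map_rank (tangent_bundle Q) (cotangent_bundle Q) (legendre Q L) w = r"
    and "\<exists>\<Gamma>. sode Q \<Gamma> \<and> (\<forall>v\<in>points (tangent_bundle Q). lagrange_eq Q L (\<Gamma> v))"
    and "vector_field Q X"
  defines "TQ \<equiv> tangent_bundle Q"
    and "ImX \<equiv> X ` points Q"
  defines "c1 \<equiv> generalized_HJ_solution Q L X"
    and "c2 \<equiv> (\<lambda>p. tangent_map Q TQ X (X p)) ` points Q \<subseteq> (\<Union>v\<in>ImX. affine_fibre Q L v)"
    and "c3 \<equiv> (\<forall>p\<in>points Q. \<forall>u\<in>tangent_space Q p.
                 pullback2 Q TQ X (omega Q L) (X p) u = differential Q (energy Q L \<circ> X) u)"
    and "c4 \<equiv> (\<forall>v\<in>ImX. \<exists>w\<in>affine_fibre Q L v. tangent_to TQ ImX w)"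
    and "c5 \<equiv> (\<forall>v\<in>ImX. \<exists>I \<gamma>. 0 \<in> I \<and> euler_lagrange_solution Q L I \<gamma> \<and>
                 velocity Q \<gamma> 0 = v \<and> (\<forall>t\<in>I. velocity Q \<gamma> t \<in> ImX))"
  shows "(c1 \<longleftrightarrow> c2) \<and> (c2 \<longleftrightarrow> c3) \<and> (c3 \<longleftrightarrow> c4) \<and> (c4 \<longleftrightarrow> c5)"
proof -
  have Q: "smooth_atlas Q" using assms(1) by (simp add: smooth_manifold_def)
  then have TQ: "smooth_atlas TQ" unfolding TQ_def by (rule smooth_atlas_tangent_bundle)
  have L: "smooth_fun TQ L" using assms(2) by (simp only: TQ_def)
  have \<tau>: "smooth_map TQ Q fst" unfolding TQ_def by (rule smooth_map_fst[OF Q])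
  have X: "smooth_map Q TQ X" using assms(5) by (simp add: vector_field_def TQ_def)
  have X_fst: "fst (X p) = p" if "p \<in> points Q" for p
    using assms(5) that by (simp add: vector_field_def)
  let ?TX = "tangent_map Q TQ X" and ?T\<tau> = "tangent_map TQ Q fst"
  have X_in: "X p \<in> tangent_space Q p" if "p \<in> points Q" for p
    by (rule vector_field_in[OF assms(5) that])
  have X_points: "X p \<in> points TQ" if "p \<in> points Q" for p by (rule smooth_map_point[OF X that])
  have TX_in: "?TX u \<in> tangent_space TQ (X p)" if "p \<in> points Q" "u \<in> tangent_space Q p" for p u
    by (rule tangent_map_in[OF Q TQ X that])
  \<comment> \<open>\<open>X\<close> is a section of \<tau>. Taking u = X(p) shows that TX(X(p)) is
    of second order; general u makes the pull-back in the third condition sufficient.\<close>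
  have \<tau>_TX: "?T\<tau> (?TX u) = u" if "p \<in> points Q" "u \<in> tangent_space Q p" for p u
    unfolding tangent_map_compose[OF Q TQ Q X \<tau> that]
    by (rule tangent_map_identity[OF Q _ that]) (simp add: X_fst)
  have TX_velocity: "velocity TQ (X \<circ> \<gamma>) t = ?TX (velocity Q \<gamma> t)" if "smooth_curve Q I \<gamma>" "t \<in> I" for I \<gamma> t
    by (rule velocity_compose[OF Q X that])
  define S where "S \<longleftrightarrow> (\<forall>p\<in>points Q. lagrange_eq Q L (?TX (X p)))"
  have S_D: "lagrange_eq Q L (?TX (X p))" if S "p \<in> points Q" for p
    using that by (simp add: S_def)
  have fibre: "?TX (X p) \<in> affine_fibre Q L (X p) \<longleftrightarrow> lagrange_eq Q L (?TX (X p))" if "p \<in> points Q" for p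
    using TX_in[OF that X_in[OF that]] \<tau>_TX[OF that X_in[OF that]] by (simp add: affine_fibre_def TQ_def)

  have "c2 \<longleftrightarrow> S"
  proof
    assume c2
    show S unfolding S_def
    proof
      fix p assume "p \<in> points Q"
      \<comment> \<open>Membership in any one fibre is enough: \<open>lagrange_eq\<close> takes the
        base point from the vector itself.\<close>
      then have "?TX (X p) \<in> (\<Union>v\<in>ImX. affine_fibre Q L v)" using \<open>c2\<close> unfolding c2_def by blast
      then show "lagrange_eq Q L (?TX (X p))" by (auto simp: affine_fibre_def)
    qed
  next
    assume S
    then show c2 unfolding c2_def ImX_def using fibre S_D by blast
  qed
  moreover have "c3 \<longleftrightarrow> S"
  proof -
    \<comment> \<open>The differential commutes with pull-back, so the third condition becomes the
      Lagrange equation for TX(X(p)) tested on vectors TX(u) only.\<close>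
    have pullback: "pullback2 Q TQ X (omega Q L) (X p) u = differential Q (energy Q L \<circ> X) u \<longleftrightarrow>
        omega Q L (?TX (X p)) (?TX u) = differential TQ (energy Q L) (?TX u)"
      if "p \<in> points Q" "u \<in> tangent_space Q p" for p u
      using differential_compose[OF Q TQ X smooth_fun_energy[OF Q L[unfolded TQ_def], folded TQ_def] that]
      by (simp add: pullback2_def)
    have "lagrange_eq Q L (?TX (X p)) \<longleftrightarrow>
        (\<forall>u\<in>tangent_space Q p. omega Q L (?TX (X p)) (?TX u) = differential TQ (energy Q L) (?TX u))"
      (is "_ \<longleftrightarrow> ?R") if p: "p \<in> points Q" for p
    proof
      note V = TX_in[OF p X_in[OF p]] \<tau>_TX[OF p X_in[OF p]]
      have base: "fst (?TX (X p)) = X p" by (rule tangent_spaceD(1)[OF V(1)])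
      show ?R if "lagrange_eq Q L (?TX (X p))"
        using that TX_in[OF p] unfolding lagrange_eq_def base TQ_def[symmetric] by blast
      assume R: ?R
      have Xp: "X p \<in> tangent_points Q" using X_points[OF p] by (simp add: TQ_def points_tangent_bundle)
      obtain h where h: "\<And>W. W \<in> tangent_space TQ (X p) \<Longrightarrow>
          omega Q L (?TX (X p)) W - differential TQ (energy Q L) W = h (?T\<tau> W)"
        using lagrange_form_semibasic[OF Q _ Xp, folded TQ_def, OF L V] by blast
      show "lagrange_eq Q L (?TX (X p))"
        unfolding lagrange_eq_def base TQ_def[symmetric]
      proof
        fix W assume W: "W \<in> tangent_space TQ (X p)"
        have u: "?T\<tau> W \<in> tangent_space Q p"
          using tangent_map_in[OF TQ Q \<tau> X_points[OF p] W] by (simp only: X_fst[OF p])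
        \<comment> \<open>The test vector is TX(u) with u = T\<tau>(W): it has the same projection
          as \<open>W\<close>, and \<open>?R\<close> says that the form vanishes on it.\<close>
        have "h (?T\<tau> W) = 0"
          using h[OF TX_in[OF p u]] R u by (simp add: \<tau>_TX[OF p u])
        then show "omega Q L (?TX (X p)) W = differential TQ (energy Q L) W" using h[OF W] by simp
      qed
    qed
    then show ?thesis unfolding c3_def S_def using pullback by simp
  qed
  moreover have "c1 \<longleftrightarrow> S"
  proof
    assume c1
    show S unfolding S_def
    proof
      fix p assume "p \<in> points Q"
      then obtain I \<gamma> where \<gamma>: "0 \<in> I" "integral_curve Q X I \<gamma>" "\<gamma> 0 = p"
        using integral_curve_exists[OF Q assms(5)] by metis
      then have "lagrange_eq Q L (velocity TQ (X \<circ> \<gamma>) 0)"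
        using \<open>c1\<close> unfolding c1_def generalized_HJ_solution_def TQ_def by blast
      then show "lagrange_eq Q L (?TX (X p))"
        using TX_velocity[of I \<gamma> 0] \<gamma> by (simp add: integral_curve_def)
    qed
  next
    assume S
    show c1 unfolding c1_def generalized_HJ_solution_def TQ_def[symmetric]
    proof (intro allI impI ballI)
      fix I \<gamma> t assume \<gamma>: "integral_curve Q X I \<gamma>" and t: "t \<in> I"
      then have \<gamma>': "smooth_curve Q I \<gamma>" "velocity Q \<gamma> t = X (\<gamma> t)" by (auto simp: integral_curve_def)
      show "lagrange_eq Q L (velocity TQ (X \<circ> \<gamma>) t)"
        unfolding TX_velocity[OF \<gamma>'(1) t] \<gamma>'(2)
        by (rule S_D[OF \<open>S\<close> smooth_curve_point[OF \<gamma>'(1) t]])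
    qed
  qed
  moreover have "c4 \<longleftrightarrow> S"
  proof
    assume c4
    show S unfolding S_def
    proof
      fix p assume p: "p \<in> points Q"
      then obtain w where w: "w \<in> affine_fibre Q L (X p)" "tangent_to TQ ImX w"
        using \<open>c4\<close> unfolding c4_def ImX_def by blast
      then obtain I \<xi> where \<xi>: "0 \<in> I" "smooth_curve TQ I \<xi>" "\<xi> ` I \<subseteq> ImX" "velocity TQ \<xi> 0 = w"
        unfolding tangent_to_def by blast
      have \<gamma>: "smooth_curve Q I (fst \<circ> \<xi>)" by (rule smooth_curve_compose[OF TQ \<tau> \<xi>(2)])
      have "\<xi> t = (X \<circ> (fst \<circ> \<xi>)) t" if "t \<in> I" for t
        using \<xi>(3) that X_fst by (auto simp: ImX_def)
      then have "w = velocity TQ (X \<circ> (fst \<circ> \<xi>)) 0"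
        unfolding \<xi>(4)[symmetric] by (rule velocity_cong[OF smooth_curve_open[OF \<gamma>] \<xi>(1)])
      also have "\<dots> = ?TX (?T\<tau> w)"
        unfolding TX_velocity[OF \<gamma> \<xi>(1)] velocity_compose[OF TQ \<tau> \<xi>(2,1)] \<xi>(4) ..
      \<comment> \<open>The projected curve need not be an integral curve of \<open>X\<close>; its
        velocity is known only at time 0, from the second order condition in
        \<open>affine_fibre\<close>.\<close>
      also have "?T\<tau> w = X p" using w(1) by (simp add: affine_fibre_def TQ_def)
      finally have "?TX (X p) = w" ..
      then show "lagrange_eq Q L (?TX (X p))" using w(1) by (simp add: affine_fibre_def)
    qed
  next
    assume S
    show c4 unfolding c4_def
    proof
      fix v assume "v \<in> ImX"
      then obtain p where p: "p \<in> points Q" and v: "v = X p" by (auto simp: ImX_def)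
      obtain I \<gamma> where \<gamma>: "0 \<in> I" "integral_curve Q X I \<gamma>" "\<gamma> 0 = p"
        using integral_curve_exists[OF Q assms(5) p] .
      then have \<gamma>': "smooth_curve Q I \<gamma>" and vel: "velocity Q \<gamma> 0 = X p" by (auto simp: integral_curve_def)
      \<comment> \<open>The lift of an integral curve through \<open>p\<close> lies in Im X and has
        velocity TX(X(p)) at 0, which is the required vector of the fibre.\<close>
      have "tangent_to TQ ImX (?TX (X p))"
        unfolding tangent_to_def
      proof (intro exI conjI)
        show "0 \<in> I" by fact
        show "smooth_curve TQ I (X \<circ> \<gamma>)" by (rule smooth_curve_compose[OF Q X \<gamma>'])
        show "(X \<circ> \<gamma>) ` I \<subseteq> ImX" using smooth_curve_point[OF \<gamma>'] by (auto simp: ImX_def)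
        show "velocity TQ (X \<circ> \<gamma>) 0 = ?TX (X p)" unfolding TX_velocity[OF \<gamma>' \<gamma>(1)] vel ..
      qed
      then show "\<exists>w\<in>affine_fibre Q L v. tangent_to TQ ImX w"
        using fibre[OF p] S_D[OF \<open>S\<close> p] v by blast
    qed
  qed
  moreover have "c5 \<longleftrightarrow> S"
  proof
    assume c5
    show S unfolding S_def
    proof
      fix p assume "p \<in> points Q"
      then obtain I \<gamma> where \<gamma>: "0 \<in> I" "euler_lagrange_solution Q L I \<gamma>" "velocity Q \<gamma> 0 = X p"
        "\<forall>t\<in>I. velocity Q \<gamma> t \<in> ImX"
        using \<open>c5\<close> unfolding c5_def ImX_def by blast
      have \<gamma>': "smooth_curve Q I \<gamma>" using \<gamma>(2) by (simp add: euler_lagrange_solution_def)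
      \<comment> \<open>A velocity has base point \<open>\<gamma> t\<close>, and Im X contains just
        one vector over it; hence \<open>\<gamma>\<close> is an integral curve of
        \<open>X\<close>.\<close>
      have "velocity Q \<gamma> t = (X \<circ> \<gamma>) t" if t: "t \<in> I" for t
      proof -
        obtain q where q: "q \<in> points Q" "velocity Q \<gamma> t = X q" using \<gamma>(4) t by (auto simp: ImX_def)
        have "q = fst (velocity Q \<gamma> t)" using q X_fst by simp
        also have "\<dots> = \<gamma> t" by (simp add: velocity_def)
        finally show ?thesis using q(2) by simp
      qed
      then have "velocity TQ (velocity Q \<gamma>) 0 = velocity TQ (X \<circ> \<gamma>) 0"
        by (rule velocity_cong[OF smooth_curve_open[OF \<gamma>'] \<gamma>(1)])
      also have "\<dots> = ?TX (X p)" unfolding TX_velocity[OF \<gamma>' \<gamma>(1)] \<gamma>(3) ..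
      finally show "lagrange_eq Q L (?TX (X p))"
        using \<gamma>(1,2) by (metis TQ_def euler_lagrange_solution_def)
    qed
  next
    assume S
    show c5 unfolding c5_def
    proof
      fix v assume "v \<in> ImX"
      then obtain p where p: "p \<in> points Q" and v: "v = X p" by (auto simp: ImX_def)
      obtain I \<gamma> where \<gamma>: "0 \<in> I" "integral_curve Q X I \<gamma>" "\<gamma> 0 = p"
        using integral_curve_exists[OF Q assms(5) p] .
      then have \<gamma>': "smooth_curve Q I \<gamma>" and vel: "\<And>t. t \<in> I \<Longrightarrow> velocity Q \<gamma> t = X (\<gamma> t)"
        by (auto simp: integral_curve_def)
      have "lagrange_eq Q L (velocity TQ (velocity Q \<gamma>) t)" if t: "t \<in> I" for t
      proof -
        have "velocity TQ (velocity Q \<gamma>) t = velocity TQ (X \<circ> \<gamma>) t"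
          by (rule velocity_cong[OF smooth_curve_open[OF \<gamma>'] t]) (simp add: vel)
        also have "\<dots> = ?TX (X (\<gamma> t))" unfolding TX_velocity[OF \<gamma>' t] vel[OF t] ..
        finally show ?thesis using S_D[OF \<open>S\<close> smooth_curve_point[OF \<gamma>' t]] by simp
      qed
      then have "euler_lagrange_solution Q L I \<gamma>"
        using \<gamma>' by (simp add: euler_lagrange_solution_def TQ_def)
      moreover have "\<forall>t\<in>I. velocity Q \<gamma> t \<in> ImX"
        using vel smooth_curve_point[OF \<gamma>'] by (auto simp: ImX_def)
      ultimately show "\<exists>I \<gamma>. 0 \<in> I \<and> euler_lagrange_solution Q L I \<gamma> \<and>
          velocity Q \<gamma> 0 = v \<and> (\<forall>t\<in>I. velocity Q \<gamma> t \<in> ImX)"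
        using \<gamma>(1,3) vel[OF \<gamma>(1)] v by blast
    qed
  qed
  ultimately show ?thesis by blast
qed

end
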